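(* Let $n\ge 1$ and let $P\subset\mathbb{R}^n$ be a full-dimensional polytope. Then $\operatorname{rank}_{\mathrm{psd}} P\ge n+1$. Furthermore, if $\operatorname{rank}_{\mathrm{psd}} P=n+1$, then every $\mathcal{S}_+^{n+1}$-factorization of a slack matrix of $P$ uses only matrices of rank one as factors.
   Context: $\mathcal{S}_+^k$ denotes the cone of $k\times k$ real symmetric positive semidefinite (psd) matrices, inside the space of real symmetric $k\times k$ matrices with inner product $\langle A,B\rangle=\operatorname{Tr}(AB)$. An $\mathcal{S}_+^k$-lift of a polytope $P\subset\mathbb{R}^n$ is a set $\mathcal{S}_+^k\cap L$, with $L$ an affine subspace of the space of real symmetric $k\times k$ matrices, such that $P=\pi(\mathcal{S}_+^k\cap L)$ for some linear map $\pi$ to $\mathbb{R}^n$. The psd rank $\operatorname{rank}_{\mathrm{psd}}P$ is the smallest positive integer $k$ such that $P$ has an $\mathcal{S}_+^k$-lift. Slack matrix: let $P\subset\mathbb{R}^n$ be a full-dimensional polytope with vertices $p_1,\dots,p_v$ and irredundant (facet) inequality representation $P=\{x\in\mathbb{R}^n:\beta_j-\langle a_j,x\rangle\ge 0,\ j=1,\dots,f\}$. The $v\times f$ nonnegative matrix with $(i,j)$-entry $\beta_j-\langle a_j,p_i\rangle$ is called a slack matrix of $P$ (it is defined up to positive scalings of its columns, since each facet inequality may be scaled by a positive number). An $\mathcal{S}_+^k$-factorization of a nonnegative matrix $M\in\mathbb{R}_+^{p\times q}$ is a collection of matrices $A_1,\dots,A_p,B_1,\dots,B_q\in\mathcal{S}_+^k$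 (called factors) with $\langle A_i,B_j\rangle=M_{ij}$ for all $i,j$. *)

theory Defs
  imports "HOL-Analysis.Analysis" "Jordan_Normal_Form.DL_Rank"
begin

text \<open>Points live in \<^typ>\<open>real ^ 'n\<close>, but the matrix size \<open>k\<close> is quantified over in the
  definition of the psd rank, so matrices are those of \<open>Jordan_Normal_Form\<close>, whose dimensions
  are values rather than types.\<close>

definition sym_mats :: "nat \<Rightarrow> real Matrix.mat set" where
  "sym_mats k = {A \<in> carrier_mat k k. transpose_mat A = A}"

definition psd_cone :: "nat \<Rightarrow> real Matrix.mat set" where
  "psd_cone k = {A \<in> sym_mats k. \<forall>x \<in> carrier_vec k. scalar_prod x (A *\<^sub>v x) \<ge> 0}"

definition mat_trace :: "real Matrix.mat \<Rightarrow> real" where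
  "mat_trace A = (\<Sum>i < dim_row A. A $$ (i, i))"

definition mat_inner :: "real Matrix.mat \<Rightarrow> real Matrix.mat \<Rightarrow> real" where
  "mat_inner A B = mat_trace (A * B)"

text \<open>The matrix type is not a real vector space, since matrices of different sizes cannot be
  added; hence \<^const>\<open>affine\<close> and \<^const>\<open>linear\<close> are relativised to the carrier
  \<^term>\<open>sym_mats k\<close>.\<close>

definition affine_sym_subspace :: "nat \<Rightarrow> real Matrix.mat set \<Rightarrow> bool" where
  "affine_sym_subspace k L \<longleftrightarrow>
     L \<subseteq> sym_mats k \<and>
     (\<forall>A \<in> L. \<forall>B \<in> L. \<forall>u v. u + v = 1 \<longrightarrow> u \<cdot>\<^sub>m A + v \<cdot>\<^sub>m B \<in> L)"

definition linear_on_sym :: "nat \<Rightarrow> (real Matrix.mat \<Rightarrow> real ^ 'n) \<Rightarrow> bool" where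
  "linear_on_sym k \<pi> \<longleftrightarrow>
     (\<forall>A \<in> sym_mats k. \<forall>B \<in> sym_mats k. \<pi> (A + B) = \<pi> A + \<pi> B) \<and>
     (\<forall>c. \<forall>A \<in> sym_mats k. \<pi> (c \<cdot>\<^sub>m A) = c *\<^sub>R \<pi> A)"

definition psd_lift :: "nat \<Rightarrow> (real ^ 'n) set \<Rightarrow> real Matrix.mat set \<Rightarrow> bool" where
  "psd_lift k P S \<longleftrightarrow>
     (\<exists>L \<pi>. affine_sym_subspace k L \<and> linear_on_sym k \<pi> \<and>
        S = psd_cone k \<inter> L \<and> P = \<pi> ` S)"

text \<open>For a polytope with \<open>v \<ge> 1\<close> vertices the minimum below exists: the diagonal matrices of size
  \<open>v\<close> and trace 1 give a lift.\<close>

definition psd_rank :: "(real ^ 'n) set \<Rightarrow> nat" where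
  "psd_rank P = (LEAST k. k > 0 \<and> (\<exists>S. psd_lift k P S))"

definition irredundant_representation ::
    "(real ^ 'n) set \<Rightarrow> nat \<Rightarrow> (nat \<Rightarrow> real ^ 'n) \<Rightarrow> (nat \<Rightarrow> real) \<Rightarrow> bool" where
  "irredundant_representation P f a \<beta> \<longleftrightarrow>
     P = {x. \<forall>j < f. \<beta> j - inner (a j) x \<ge> 0} \<and>
     (\<forall>i < f. P \<noteq> {x. \<forall>j < f. j \<noteq> i \<longrightarrow> \<beta> j - inner (a j) x \<ge> 0})"

text \<open>Slack matrices are unique only up to positive column scalings (and the order of vertices and
  inequalities), so this is a relation. It is intended for full-dimensional polytopes \<open>P\<close>, for
  which the inequalities of an irredundant representation correspond exactly to the facets.\<close>

definition slack_matrix :: "(real ^ 'n) set \<Rightarrow> real Matrix.mat \<Rightarrow> bool" where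
  "slack_matrix P M \<longleftrightarrow>
     (\<exists>v f p a \<beta>. bij_betw p {..<v} {x. x extreme_point_of P} \<and>
        irredundant_representation P f a \<beta> \<and>
        M = Matrix.mat v f (\<lambda>(i, j). \<beta> j - inner (a j) (p i)))"

definition psd_factorization ::
    "nat \<Rightarrow> real Matrix.mat \<Rightarrow> (nat \<Rightarrow> real Matrix.mat) \<Rightarrow> (nat \<Rightarrow> real Matrix.mat) \<Rightarrow> bool" where
  "psd_factorization k M A B \<longleftrightarrow>
     (\<forall>i < dim_row M. A i \<in> psd_cone k) \<and>
     (\<forall>j < dim_col M. B j \<in> psd_cone k) \<and>
     (\<forall>i < dim_row M. \<forall>j < dim_col M. mat_inner (A i) (B j) = M $$ (i, j))"

end

theory Submission
  imports Defs "Jordan_Normal_Form.Matrix_Kernel"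
begin

text \<open>Both claims come from one principle: along a flag of faces of \<open>P\<close>, starting at a vertex and
  raising the dimension by one at each step, the rank of suitable psd matrices strictly increases.

  For a lift \<open>S \<rightarrow> P\<close>, take matrices of \<open>S\<close> lying over the faces. If \<open>A\<close> lies over a face \<open>F\<close> and \<open>B\<close>
  lies over a point outside \<open>F\<close>, then \<open>ker A \<subseteq> ker B\<close> is impossible: otherwise \<open>A + e (A - B)\<close> would
  still be in \<open>S\<close> for small \<open>e > 0\<close>, contradicting that \<open>F\<close> is a face. So \<open>(A + B) / 2\<close> has larger
  rank than \<open>A\<close>. Over a vertex there is a nonzero matrix, because \<open>P\<close> is bounded; hence the rank
  reaches \<open>n + 1\<close>.

  For a factorization, take sums of vertex factors \<open>A\<^sub>i\<close> over the faces. If a facet inequality \<open>j\<close> is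
  tight on \<open>F\<close> but not on a vertex \<open>p\<^sub>i\<close> of a larger face, then the range of \<open>B\<^sub>j\<close> is in the kernel
  of the sum over \<open>F\<close> but not in the kernel of \<open>A\<^sub>i\<close>. Thus the ranks grow from \<open>rank A\<^sub>i\<close> to at least
  \<open>rank A\<^sub>i + n\<close>, which forces \<open>rank A\<^sub>i = 1\<close> in size \<open>n + 1\<close>; and a flag ending in facet \<open>j\<close> gives
  a matrix of rank at least \<open>n\<close> which annihilates \<open>B\<^sub>j\<close>.\<close>

section \<open>Rank and kernel\<close>

text \<open>A subset of \<open>W\<close> that is independent in \<open>W\<close> is independent in
  \<open>V\<close>, so its size is bounded by \<open>dim\<close>. Hence a maximal one exists, and it
  is a finite basis of \<open>W\<close>.\<close>

lemma (in vectorspace) fin_dim_subspace: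
  assumes W: "VectorSpace.subspace K W V" and "fin_dim"
  shows "vectorspace.fin_dim K (vs W)"
proof -
  interpret W: vectorspace K "vs W"
    by (rule subspace_is_vs[OF W])
  have sub: "LinearCombinations.submodule K W V" and WV: "W \<subseteq> carrier V"
    using W by (auto simp: VectorSpace.subspace_def LinearCombinations.submodule_def)
  have "\<exists>S. finite S \<and> maximal S (\<lambda>S. S \<subseteq> carrier (vs W) \<and> W.lin_indpt S)"
  proof (rule maximal_exists[where N = dim and B = "{}"])
    fix S assume S: "S \<subseteq> carrier (vs W) \<and> W.lin_indpt S"
    then have "lin_indpt S"
      using span_li_not_depend(2)[OF _ sub, of S] by simp
    then show "finite S \<and> card S \<le> dim"
      using li_le_dim[OF \<open>fin_dim\<close>, of S] S WV by auto
  qed (auto simp: W.lin_dep_def)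
  then obtain S where "finite S" "W.basis S"
    using W.max_li_is_basis by (auto simp: maximal_def)
  then show ?thesis
    unfolding W.fin_dim_def W.basis_def by blast
qed

text \<open>Adding \<open>x\<close> to a basis of \<open>W\<close> leaves it independent in
  \<open>V\<close>, so \<open>dim\<close> exceeds the dimension of \<open>W\<close> by at least
  one.\<close>

lemma (in vectorspace) subspace_dim_less:
  assumes W: "VectorSpace.subspace K W V" and "fin_dim" and x: "x \<in> carrier V" "x \<notin> W"
  shows "vectorspace.dim K (vs W) < dim"
proof -
  interpret W: vectorspace K "vs W"
    by (rule subspace_is_vs[OF W])
  have sub: "LinearCombinations.submodule K W V" and WV: "W \<subseteq> carrier V"
    using W by (auto simp: VectorSpace.subspace_def LinearCombinations.submodule_def)
  obtain b where b: "finite b" "W.basis b"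
    using W.finite_basis_exists fin_dim_subspace[OF assms(1,2)] by blast
  then have bW: "b \<subseteq> W" and "W.lin_indpt b" and "W.span b = W"
    by (auto simp: W.basis_def)
  then have li: "lin_indpt b" and span: "span b = W"
    using span_li_not_depend[OF bW sub] by auto
  have "x \<notin> b"
    using x bW by auto
  then have "lin_indpt (b \<union> {x})"
    using lin_dep_iff_in_span[of b x] li x span bW WV by auto
  then have "card (b \<union> {x}) \<le> dim"
    using li_le_dim(2)[OF \<open>fin_dim\<close>, of "b \<union> {x}"] x bW WV by auto
  then show ?thesis
    using W.dim_basis[OF b] \<open>x \<notin> b\<close> b(1) by simp
qed

section \<open>Rank-nullity and rank inequalities for matrices\<close>

context
  fixes A :: "'a :: field Matrix.mat" and nr nc :: nat
  assumes A: "A \<in> carrier_mat nr nc"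
begin

lemma linear_map_mult_mat_vec:
  "linear_map class_ring (module_vec TYPE('a) nc) (module_vec TYPE('a) nr) (\<lambda>v. A *\<^sub>v v)"
proof -
  interpret V: vec_space "TYPE('a)" nc .
  interpret W: vec_space "TYPE('a)" nr .
  show ?thesis
    using A by unfold_locales
      (auto simp: module_hom_def module_vec_simps mult_add_distrib_mat_vec mult_mat_vec)
qed

lemma subspace_mat_kernel:
  "VectorSpace.subspace class_ring (mat_kernel A) (module_vec TYPE('a) nc)"
proof -
  interpret linear_map class_ring "module_vec TYPE('a) nc" "module_vec TYPE('a) nr" "\<lambda>v. A *\<^sub>v v"
    by (rule linear_map_mult_mat_vec)
  have "kerT = mat_kernel A"
    by (auto simp: ker_def mat_kernel[OF A] module_vec_simps)
  then show ?thesis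
    using kerT_is_subspace by simp
qed

text \<open>Rank-nullity for the map \<open>v\<close> to \<open>A v\<close>: its image is the column
  space, whose dimension defines the rank.\<close>

lemma rank_nullity_mat:
  "vec_space.rank nr A + kernel.dim nc A = nc"
proof -
  interpret V: vec_space "TYPE('a)" nc .
  interpret W: vec_space "TYPE('a)" nr .
  interpret linear_map class_ring "module_vec TYPE('a) nc" "module_vec TYPE('a) nr" "\<lambda>v. A *\<^sub>v v"
    by (rule linear_map_mult_mat_vec)
  have ker: "kerT = mat_kernel A"
    by (auto simp: ker_def mat_kernel[OF A] module_vec_simps)
  have im: "imT = W.span (set (cols A))"
    using W.col_space_eq[OF A] A by (auto simp: im_def module_vec_simps W.col_space_def)
  show ?thesis
    using rank_nullity[OF V.fin_dim] unfolding ker im W.rank_def V.dim_is_n .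
qed

end

text \<open>By rank-nullity, ranks of matrices with the same number of columns compare oppositely to
  the dimensions of their kernels. This is how rank growth is detected along a flag.\<close>

lemma rank_less_if_mat_kernel_psubset:
  fixes A B :: "'a :: field Matrix.mat"
  assumes A: "A \<in> carrier_mat nr nc" and B: "B \<in> carrier_mat nr' nc"
    and sub: "mat_kernel B \<subset> mat_kernel A"
  shows "vec_space.rank nr A < vec_space.rank nr' B"
proof -
  interpret V: vec_space "TYPE('a)" nc .
  let ?K = "V.vs (mat_kernel A)"
  interpret K: vectorspace class_ring ?K
    by (rule V.subspace_is_vs[OF subspace_mat_kernel[OF A]])
  obtain x where x: "x \<in> mat_kernel A" "x \<notin> mat_kernel B"
    using sub by blast
  have "VectorSpace.subspace class_ring (mat_kernel B) ?K"
    using V.nested_subspaces[OF subspace_mat_kernel[OF A] subspace_mat_kernel[OF B]] sub by blast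
  moreover have "K.fin_dim"
    using V.fin_dim_subspace[OF subspace_mat_kernel[OF A] V.fin_dim] .
  ultimately have "vectorspace.dim class_ring (K.vs (mat_kernel B)) < K.dim"
    using K.subspace_dim_less[of "mat_kernel B" x] x by simp
  then have "kernel.dim nc B < kernel.dim nc A"
    by simp
  then show ?thesis
    using rank_nullity_mat[OF A] rank_nullity_mat[OF B] by linarith
qed

text \<open>The columns of \<open>B\<close> lie in the kernel of \<open>A\<close>, whose dimension
  is \<open>n\<close> minus the rank of \<open>A\<close>.\<close>

lemma rank_add_rank_le_if_mult_eq_0:
  fixes A B :: "'a :: field Matrix.mat"
  assumes A: "A \<in> carrier_mat nr n" and B: "B \<in> carrier_mat n nc" and AB: "A * B = 0\<^sub>m nr nc"
  shows "vec_space.rank nr A + vec_space.rank n B \<le> n"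
proof -
  interpret V: vec_space "TYPE('a)" n .
  let ?K = "V.vs (mat_kernel A)"
  interpret K: vectorspace class_ring ?K
    by (rule V.subspace_is_vs[OF subspace_mat_kernel[OF A]])
  have cols: "set (cols B) \<subseteq> carrier_vec n"
    using B cols_dim by blast
  have "V.span (set (cols B)) \<subseteq> mat_kernel A"
  proof
    fix y assume "y \<in> V.span (set (cols B))"
    then obtain x where x: "x \<in> carrier_vec nc" "y = B *\<^sub>v x"
      using V.col_space_eq[OF B] B by (auto simp: V.col_space_def)
    have "A *\<^sub>v (B *\<^sub>v x) = (A * B) *\<^sub>v x"
      using A B x by (simp add: assoc_mult_mat_vec)
    then show "y \<in> mat_kernel A"
      using A B AB x by (auto intro!: mat_kernelI)
  qed
  then have "VectorSpace.subspace class_ring (V.span (set (cols B))) ?K"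
    using V.nested_subspaces[OF subspace_mat_kernel[OF A] V.span_is_subspace] cols by simp
  moreover have "K.fin_dim"
    using V.fin_dim_subspace[OF subspace_mat_kernel[OF A] V.fin_dim] .
  ultimately have "vectorspace.dim class_ring (K.vs (V.span (set (cols B)))) \<le> K.dim"
    using K.subspace_dim K.fin_dim_subspace by blast
  then have "V.rank B \<le> kernel.dim n A"
    by (simp add: V.rank_def)
  then show ?thesis
    using rank_nullity_mat[OF A] by linarith
qed

text \<open>If all unit vectors were in the kernel, all entries would vanish. So the kernel is
  strictly smaller than that of the zero matrix, and the rank strictly larger.\<close>

lemma rank_pos_if_nonzero:
  fixes A :: "'a :: field Matrix.mat"
  assumes A: "A \<in> carrier_mat nr nc" and "A \<noteq> 0\<^sub>m nr nc"
  shows "vec_space.rank nr A > 0"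
proof -
  have "mat_kernel A \<noteq> carrier_vec nc"
  proof
    assume ker: "mat_kernel A = carrier_vec nc"
    have "A $$ (i, j) = 0" if "i < nr" "j < nc" for i j
    proof -
      have "A *\<^sub>v unit_vec nc j = 0\<^sub>v nr"
        using ker mat_kernelD(2)[OF A, of "unit_vec nc j"] by simp
      then have "(A *\<^sub>v unit_vec nc j) $ i = 0"
        using that by simp
      then show ?thesis
        using A that by simp
    qed
    then show False
      using A \<open>A \<noteq> 0\<^sub>m nr nc\<close> by (auto intro!: eq_matI)
  qed
  then have "mat_kernel A \<subset> mat_kernel (0\<^sub>m nr nc :: 'a Matrix.mat)"
    using mat_kernel_carrier[OF A] by (auto simp: mat_kernel[OF zero_carrier_mat] intro!: eq_vecI)
  then have "vec_space.rank nr (0\<^sub>m nr nc :: 'a Matrix.mat) < vec_space.rank nr A"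
    by (rule rank_less_if_mat_kernel_psubset[OF zero_carrier_mat A])
  then show ?thesis
    by simp
qed

section \<open>Positive semidefinite matrices\<close>

lemma psd_coneD:
  assumes "A \<in> psd_cone k"
  shows "A \<in> carrier_mat k k" "transpose_mat A = A"
    "x \<in> carrier_vec k \<Longrightarrow> scalar_prod x (A *\<^sub>v x) \<ge> 0"
  using assms by (auto simp: psd_cone_def sym_mats_def)

lemma sym_mat_scalar_prod:
  fixes A :: "real Matrix.mat"
  assumes "A \<in> carrier_mat k k" "transpose_mat A = A" "x \<in> carrier_vec k" "y \<in> carrier_vec k"
  shows "scalar_prod x (A *\<^sub>v y) = scalar_prod y (A *\<^sub>v x)"
proof -
  have "scalar_prod x (A *\<^sub>v y) = scalar_prod (A *\<^sub>v y) x"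
    using assms by (intro comm_scalar_prod[of _ k]) auto
  also have "\<dots> = scalar_prod y (transpose_mat A *\<^sub>v x)"
    using assms by (metis transpose_vec_mult_scalar comm_scalar_prod mult_mat_vec_carrier transpose_carrier_mat)
  finally show ?thesis
    using assms by simp
qed

section \<open>The Cauchy-Schwarz inequality and kernels of psd matrices\<close>

lemma psd_quadratic_expansion:
  fixes t :: real
  assumes "A \<in> psd_cone k" and x: "x \<in> carrier_vec k" and y: "y \<in> carrier_vec k"
  shows "scalar_prod (x + t \<cdot>\<^sub>v y) (A *\<^sub>v (x + t \<cdot>\<^sub>v y))
    = scalar_prod x (A *\<^sub>v x) + 2 * t * scalar_prod y (A *\<^sub>v x) + t\<^sup>2 * scalar_prod y (A *\<^sub>v y)"
proof -
  note A = psd_coneD(1,2)[OF assms(1)]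
  have "A *\<^sub>v (x + t \<cdot>\<^sub>v y) = A *\<^sub>v x + t \<cdot>\<^sub>v (A *\<^sub>v y)"
    using A x y by (simp add: mult_add_distrib_mat_vec mult_mat_vec)
  moreover have "scalar_prod (x + t \<cdot>\<^sub>v y) (A *\<^sub>v x + t \<cdot>\<^sub>v (A *\<^sub>v y))
    = scalar_prod x (A *\<^sub>v x) + t * scalar_prod x (A *\<^sub>v y) + t * scalar_prod y (A *\<^sub>v x)
      + t * t * scalar_prod y (A *\<^sub>v y)"
    using A x y
    by (simp add: add_scalar_prod_distrib[of _ k] scalar_prod_add_distrib[of _ k] algebra_simps)
  ultimately show ?thesis
    using sym_mat_scalar_prod[OF A x y] by (simp add: power2_eq_square)
qed

text \<open>The quadratic form along the line \<open>x + t y\<close> is a quadratic polynomial in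
  \<open>t\<close> that is never negative. Its leading coefficient \<open>c\<close> may vanish, as
  \<open>A\<close> is only semidefinite.\<close>

lemma psd_Cauchy_Schwarz:
  assumes A: "A \<in> psd_cone k" and x: "x \<in> carrier_vec k" and y: "y \<in> carrier_vec k"
  shows "(scalar_prod y (A *\<^sub>v x))\<^sup>2 \<le> scalar_prod x (A *\<^sub>v x) * scalar_prod y (A *\<^sub>v y)"
proof -
  define a b c where "a = scalar_prod x (A *\<^sub>v x)" and "b = scalar_prod y (A *\<^sub>v x)"
    and "c = scalar_prod y (A *\<^sub>v y)"
  have nonneg: "a + 2 * t * b + t\<^sup>2 * c \<ge> 0" for t
    using psd_coneD(3)[OF A, of "x + t \<cdot>\<^sub>v y"] x y psd_quadratic_expansion[OF A x y, of t]
    unfolding a_def b_def c_def by simp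
  have "a \<ge> 0" "c \<ge> 0"
    unfolding a_def c_def using psd_coneD(3)[OF A] x y by auto
  have "b\<^sup>2 \<le> a * c"
  proof (cases "c = 0")
    case True
    have "b = 0"
    proof (rule ccontr)
      assume "b \<noteq> 0"
      \<comment> \<open>For \<open>c = 0\<close> the polynomial is affine in \<open>t\<close>; the
        chosen \<open>t\<close> gives it the value -1.\<close>
      then show False
        using nonneg[of "- (a + 1) / (2 * b)"] True by (simp add: field_simps)
    qed
    then show ?thesis
      using True by simp
  next
    case False
    \<comment> \<open>The minimum of the polynomial, attained at \<open>t = - b / c\<close>.\<close>
    then have "a - b\<^sup>2 / c \<ge> 0"
      using nonneg[of "- b / c"] by (simp add: field_simps power2_eq_square)
    then show ?thesis
      using False \<open>c \<ge> 0\<close> by (simp add: field_simps)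
  qed
  then show ?thesis
    unfolding a_def b_def c_def .
qed

lemma real_vec_scalar_prod_self_eq_0:
  fixes v :: "real Matrix.vec"
  assumes "v \<in> carrier_vec k" "scalar_prod v v = 0"
  shows "v = 0\<^sub>v k"
proof -
  have "(\<Sum>i = 0..<k. vec_index v i * vec_index v i) = 0"
    using assms by (simp add: scalar_prod_def)
  then have "\<forall>i\<in>{0..<k}. vec_index v i * vec_index v i = 0"
    by (subst (asm) sum_nonneg_eq_0_iff) auto
  then show ?thesis
    using assms(1) by (intro eq_vecI) auto
qed

text \<open>Cauchy-Schwarz with \<open>y = A x\<close> bounds the squared length of
  \<open>A x\<close> by zero.\<close>

lemma psd_mult_vec_eq_0:
  assumes A: "A \<in> psd_cone k" and x: "x \<in> carrier_vec k" and "scalar_prod x (A *\<^sub>v x) = 0"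
  shows "A *\<^sub>v x = 0\<^sub>v k"
proof -
  have Ax: "A *\<^sub>v x \<in> carrier_vec k"
    using psd_coneD(1)[OF A] x by simp
  have "(scalar_prod (A *\<^sub>v x) (A *\<^sub>v x))\<^sup>2 \<le> 0"
    using psd_Cauchy_Schwarz[OF A x Ax] assms(3) by simp
  then show ?thesis
    using real_vec_scalar_prod_self_eq_0[OF Ax] by simp
qed

lemma quadratic_form_combination:
  fixes A B :: "real Matrix.mat"
  assumes "A \<in> carrier_mat k k" "B \<in> carrier_mat k k" "x \<in> carrier_vec k"
  shows "scalar_prod x ((s \<cdot>\<^sub>m A + t \<cdot>\<^sub>m B) *\<^sub>v x)
    = s * scalar_prod x (A *\<^sub>v x) + t * scalar_prod x (B *\<^sub>v x)"
proof -
  have smult: "(c \<cdot>\<^sub>m C) *\<^sub>v x = c \<cdot>\<^sub>v (C *\<^sub>v x)" if "C \<in> carrier_mat k k" for c :: real and C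
    using that assms(3) by (auto intro!: eq_vecI)
  show ?thesis
    using assms by (simp add: add_mult_distrib_mat_vec[of _ k k] smult scalar_prod_add_distrib[of _ k])
qed

lemma sym_mats_combination:
  assumes "A \<in> sym_mats k" "B \<in> sym_mats k"
  shows "s \<cdot>\<^sub>m A + t \<cdot>\<^sub>m B \<in> sym_mats k"
proof -
  have A: "A \<in> carrier_mat k k" "B \<in> carrier_mat k k" "transpose_mat A = A" "transpose_mat B = B"
    using assms by (auto simp: sym_mats_def)
  have "A $$ (j, i) = A $$ (i, j)" "B $$ (j, i) = B $$ (i, j)" if "i < k" "j < k" for i j
    using A that by (metis carrier_matD index_transpose_mat(1))+
  then show ?thesis
    using A(1,2) by (auto simp: sym_mats_def intro!: eq_matI)
qed

lemma psd_cone_combination: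
  assumes A: "A \<in> psd_cone k" and B: "B \<in> psd_cone k" and "s \<ge> 0" "t \<ge> 0"
  shows "s \<cdot>\<^sub>m A + t \<cdot>\<^sub>m B \<in> psd_cone k"
  using assms sym_mats_combination[of A k B s t] psd_coneD[OF A] psd_coneD[OF B]
    quadratic_form_combination[of A k B _ s t]
  by (auto simp: psd_cone_def)

text \<open>On a kernel vector of the combination two nonnegative quadratic forms with positive
  weights add up to zero, so each vanishes there.\<close>

lemma mat_kernel_psd_combination:
  assumes A: "A \<in> psd_cone k" and B: "B \<in> psd_cone k" and "s > 0" "t > 0"
  shows "mat_kernel (s \<cdot>\<^sub>m A + t \<cdot>\<^sub>m B) \<subseteq> mat_kernel A \<inter> mat_kernel B"
proof
  note cA = psd_coneD(1)[OF A] and cB = psd_coneD(1)[OF B]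
  have C: "s \<cdot>\<^sub>m A + t \<cdot>\<^sub>m B \<in> carrier_mat k k"
    using cA cB by simp
  fix x assume "x \<in> mat_kernel (s \<cdot>\<^sub>m A + t \<cdot>\<^sub>m B)"
  then have x: "x \<in> carrier_vec k" and "(s \<cdot>\<^sub>m A + t \<cdot>\<^sub>m B) *\<^sub>v x = 0\<^sub>v k"
    using mat_kernelD[OF C] by auto
  then have "s * scalar_prod x (A *\<^sub>v x) + t * scalar_prod x (B *\<^sub>v x) = 0"
    using quadratic_form_combination[OF cA cB x, of s t] by simp
  then have "scalar_prod x (A *\<^sub>v x) = 0" "scalar_prod x (B *\<^sub>v x) = 0"
    using assms(3,4) psd_coneD(3)[OF A x] psd_coneD(3)[OF B x]
    by (smt (verit) mult_pos_pos mult_nonneg_nonneg)+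
  then show "x \<in> mat_kernel A \<inter> mat_kernel B"
    using psd_mult_vec_eq_0 A B cA cB x by (auto intro!: mat_kernelI)
qed

text \<open>The quadratic form takes the value \<open>A $$ (i, i)\<close> at the unit vector
  \<open>i\<close>; if it is zero, \<open>psd_mult_vec_eq_0\<close> kills column
  \<open>i\<close>.\<close>

lemma psd_diag:
  assumes A: "A \<in> psd_cone k" and i: "i < k"
  shows "A $$ (i, i) \<ge> 0" "A $$ (i, i) = 0 \<Longrightarrow> j < k \<Longrightarrow> A $$ (j, i) = 0"
proof -
  have Ae: "A *\<^sub>v unit_vec k i = col A i"
    using psd_coneD(1)[OF A] i by (auto intro!: eq_vecI)
  have eAe: "scalar_prod (unit_vec k i) (A *\<^sub>v unit_vec k i) = A $$ (i, i)"
    using psd_coneD(1)[OF A] i unfolding Ae by simp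
  then show "A $$ (i, i) \<ge> 0"
    using psd_coneD(3)[OF A, of "unit_vec k i"] by simp
  assume "A $$ (i, i) = 0" "j < k"
  then have "col A i = 0\<^sub>v k"
    using psd_mult_vec_eq_0[OF A, of "unit_vec k i"] eAe Ae by simp
  then have "vec_index (col A i) j = 0"
    using \<open>j < k\<close> by simp
  then show "A $$ (j, i) = 0"
    using psd_coneD(1)[OF A] i \<open>j < k\<close> by simp
qed

section \<open>Sums of rank-one matrices and trace orthogonality\<close>

lemma quadratic_form_as_sum:
  fixes A :: "real Matrix.mat"
  assumes "A \<in> carrier_mat k k" "x \<in> carrier_vec k" "y \<in> carrier_vec k"
  shows "scalar_prod x (A *\<^sub>v y) = (\<Sum>i<k. \<Sum>j<k. vec_index x i * A $$ (i, j) * vec_index y j)"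
  using assms by (simp add: scalar_prod_def atLeast0LessThan sum_distrib_left mult.assoc)

text \<open>Plays the role of a spectral decomposition. Induction on the number of nonzero diagonal
  entries: without any, the matrix vanishes by \<open>psd_diag\<close>; otherwise one rank-one term
  is split off.\<close>

lemma psd_rank_one_decomposition:
  assumes "A \<in> psd_cone k"
  shows "\<exists>vs. set vs \<subseteq> carrier_vec k \<and> (\<forall>i<k. \<forall>j<k. A $$ (i, j) = (\<Sum>v\<leftarrow>vs. vec_index v i * vec_index v j))"
  using assms
proof (induction "card {i. i < k \<and> A $$ (i, i) \<noteq> 0}" arbitrary: A rule: less_induct)
  case less
  note A = less.prems
  note cA = psd_coneD(1)[OF A]
  have symA: "A $$ (i, j) = A $$ (j, i)" if "i < k" "j < k" for i j
    using psd_coneD(2)[OF A] cA that by (metis carrier_matD index_transpose_mat(1))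
  show ?case
  proof (cases "\<exists>i<k. A $$ (i, i) \<noteq> 0")
    case False
    then have "\<forall>i<k. \<forall>j<k. A $$ (i, j) = 0"
      using psd_diag(2)[OF A] by blast
    then show ?thesis
      by (intro exI[of _ "[]"]) auto
  next
    case True
    then obtain l where l: "l < k" "A $$ (l, l) > 0"
      using psd_diag(1)[OF A] by (metis less_eq_real_def)
    \<comment> \<open>Subtracting the rank-one matrix of the \<open>l\<close>-th column (a Cholesky step) clears row and column \<open>l\<close>.\<close>
    define d where "d = A $$ (l, l)"
    define v where "v = Matrix.vec k (\<lambda>i. A $$ (i, l) / sqrt d)"
    define B where "B = Matrix.mat k k (\<lambda>(i, j). A $$ (i, j) - vec_index v i * vec_index v j)"
    have d: "d > 0"
      using l d_def by simp
    have v: "v \<in> carrier_vec k"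
      unfolding v_def by simp
    have cB: "B \<in> carrier_mat k k"
      unfolding B_def by simp
    have "transpose_mat B = B"
      unfolding B_def using symA by (auto intro!: eq_matI)
    \<comment> \<open>Subtracting the rank-one term lowers the form at \<open>x\<close> by the
      square of \<open>x^T A e_l\<close> divided by \<open>d\<close>; Cauchy-Schwarz for
      \<open>x\<close> and \<open>e_l\<close> says that at least zero remains.\<close>
    moreover have "scalar_prod x (B *\<^sub>v x) \<ge> 0" if x: "x \<in> carrier_vec k" for x
    proof -
      have "scalar_prod x (B *\<^sub>v x) = scalar_prod x (A *\<^sub>v x) - (\<Sum>i<k. vec_index x i * vec_index v i)\<^sup>2"
        unfolding quadratic_form_as_sum[OF cB x x] quadratic_form_as_sum[OF cA x x]
        by (simp add: B_def power2_eq_square sum_product sum_subtractf algebra_simps)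
      moreover have "(\<Sum>i<k. vec_index x i * vec_index v i) = scalar_prod x (A *\<^sub>v unit_vec k l) / sqrt d"
      proof -
        have "A *\<^sub>v unit_vec k l = col A l"
          using cA l by (auto intro!: eq_vecI)
        then show ?thesis
          using cA l x by (simp add: scalar_prod_def v_def atLeast0LessThan sum_divide_distrib)
      qed
      moreover have "(scalar_prod x (A *\<^sub>v unit_vec k l))\<^sup>2 \<le> d * scalar_prod x (A *\<^sub>v x)"
        using psd_Cauchy_Schwarz[OF A, of "unit_vec k l" x] x cA l unfolding d_def by simp
      ultimately have "scalar_prod x (B *\<^sub>v x)
          = scalar_prod x (A *\<^sub>v x) - (scalar_prod x (A *\<^sub>v unit_vec k l))\<^sup>2 / d"
        and "(scalar_prod x (A *\<^sub>v unit_vec k l))\<^sup>2 / d \<le> scalar_prod x (A *\<^sub>v x)"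
        using d by (simp_all add: power_divide divide_le_eq mult.commute)
      then show ?thesis
        by simp
    qed
    ultimately have B: "B \<in> psd_cone k"
      using cB by (simp add: psd_cone_def sym_mats_def)
    have "B $$ (l, l) = 0"
      using l d by (simp add: B_def v_def d_def[symmetric] field_simps)
    \<comment> \<open>A zero diagonal entry of \<open>A\<close> forces
      \<open>A $$ (i, l) = 0\<close>, so \<open>v\<close> vanishes at \<open>i\<close>: no new
      nonzero diagonal entry arises, while entry \<open>l\<close> is cleared.\<close>
    moreover have "B $$ (i, i) = 0" if "i < k" "A $$ (i, i) = 0" for i
    proof -
      have "A $$ (i, l) = 0"
        using psd_diag(2)[OF A that l(1)] symA that l by simp
      then show ?thesis
        using that by (simp add: B_def v_def)
    qed
    ultimately have "{i. i < k \<and> B $$ (i, i) \<noteq> 0} \<subset> {i. i < k \<and> A $$ (i, i) \<noteq> 0}"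
      using l by (auto simp: psubset_eq set_eq_iff)
    then have "card {i. i < k \<and> B $$ (i, i) \<noteq> 0} < card {i. i < k \<and> A $$ (i, i) \<noteq> 0}"
      by (intro psubset_card_mono) auto
    then obtain vs where vs: "set vs \<subseteq> carrier_vec k"
        "\<forall>i<k. \<forall>j<k. B $$ (i, j) = (\<Sum>v\<leftarrow>vs. vec_index v i * vec_index v j)"
      using less.hyps B by blast
    have "A $$ (i, j) = vec_index v i * vec_index v j + B $$ (i, j)" if "i < k" "j < k" for i j
      using that by (simp add: B_def)
    then show ?thesis
      using vs v by (intro exI[of _ "v # vs"]) auto
  qed
qed

lemma sum_sum_list_swap:
  "(\<Sum>i\<in>I. \<Sum>v\<leftarrow>vs. f i v) = (\<Sum>v\<leftarrow>vs. \<Sum>i\<in>I. f i v :: 'a :: comm_monoid_add)"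
  by (induction vs) (auto simp: sum.distrib)

text \<open>With \<open>B\<close> the sum of the matrices \<open>v v^T\<close>, the trace of
  \<open>A B\<close> is the sum of \<open>v^T A v\<close>, the product \<open>A B\<close> is the sum
  of \<open>(A v) v^T\<close>, and \<open>x^T B x\<close> is a sum of squares.\<close>

lemma psd_rank_one_decompositionE:
  assumes "B \<in> psd_cone k"
  obtains vs where "set vs \<subseteq> carrier_vec k"
    "\<And>A. A \<in> carrier_mat k k \<Longrightarrow> mat_inner A B = (\<Sum>v\<leftarrow>vs. scalar_prod v (A *\<^sub>v v))"
    "\<And>A. A \<in> carrier_mat k k \<Longrightarrow> (\<And>v. v \<in> set vs \<Longrightarrow> A *\<^sub>v v = 0\<^sub>v k) \<Longrightarrow> A * B = 0\<^sub>m k k"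
    "\<And>x. x \<in> carrier_vec k \<Longrightarrow> scalar_prod x (B *\<^sub>v x) = (\<Sum>v\<leftarrow>vs. (scalar_prod v x)\<^sup>2)"
proof -
  note cB = psd_coneD(1)[OF assms]
  obtain vs where vs: "set vs \<subseteq> carrier_vec k"
      "\<forall>i<k. \<forall>j<k. B $$ (i, j) = (\<Sum>v\<leftarrow>vs. vec_index v i * vec_index v j)"
    using psd_rank_one_decomposition[OF assms] by blast
  show thesis
  proof
    show "set vs \<subseteq> carrier_vec k"
      by fact
  next
    fix A :: "real Matrix.mat" assume A: "A \<in> carrier_mat k k"
    have "mat_inner A B = (\<Sum>i<k. \<Sum>j<k. A $$ (i, j) * B $$ (j, i))"
      using A cB by (simp add: mat_inner_def mat_trace_def scalar_prod_def atLeast0LessThan)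
    also have "\<dots> = (\<Sum>i<k. \<Sum>j<k. \<Sum>v\<leftarrow>vs. vec_index v i * A $$ (i, j) * vec_index v j)"
      using vs(2) by (intro sum.cong refl) (simp add: sum_list_const_mult[symmetric] mult_ac)
    also have "\<dots> = (\<Sum>v\<leftarrow>vs. \<Sum>i<k. \<Sum>j<k. vec_index v i * A $$ (i, j) * vec_index v j)"
      by (simp add: sum_sum_list_swap)
    also have "\<dots> = (\<Sum>v\<leftarrow>vs. scalar_prod v (A *\<^sub>v v))"
      using vs(1) A by (intro arg_cong[of _ _ sum_list] map_cong refl)
        (auto simp: quadratic_form_as_sum[of _ k])
    finally show "mat_inner A B = (\<Sum>v\<leftarrow>vs. scalar_prod v (A *\<^sub>v v))" .
  next
    fix A :: "real Matrix.mat"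
    assume A: "A \<in> carrier_mat k k" and ker: "\<And>v. v \<in> set vs \<Longrightarrow> A *\<^sub>v v = 0\<^sub>v k"
    have "(A * B) $$ (i, j) = 0" if ij: "i < k" "j < k" for i j
    proof -
      have "(A * B) $$ (i, j) = (\<Sum>l<k. A $$ (i, l) * B $$ (l, j))"
        using A cB ij by (simp add: scalar_prod_def atLeast0LessThan)
      also have "\<dots> = (\<Sum>l<k. \<Sum>v\<leftarrow>vs. A $$ (i, l) * vec_index v l * vec_index v j)"
        using vs(2) ij by (intro sum.cong refl) (simp add: sum_list_const_mult[symmetric] mult_ac)
      also have "\<dots> = (\<Sum>v\<leftarrow>vs. (\<Sum>l<k. A $$ (i, l) * vec_index v l) * vec_index v j)"
        by (simp add: sum_sum_list_swap sum_distrib_right)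
      also have "\<dots> = (\<Sum>v\<leftarrow>vs. 0)"
      proof (intro arg_cong[of _ _ sum_list] map_cong refl)
        fix v assume "v \<in> set vs"
        then have "vec_index (A *\<^sub>v v) i = 0" "v \<in> carrier_vec k"
          using ker vs(1) ij by auto
        then show "(\<Sum>l<k. A $$ (i, l) * vec_index v l) * vec_index v j = 0"
          using A ij by (simp add: scalar_prod_def atLeast0LessThan)
      qed
      finally show ?thesis
        by simp
    qed
    then show "A * B = 0\<^sub>m k k"
      using A cB by (intro eq_matI) auto
  next
    fix x :: "real Matrix.vec" assume x: "x \<in> carrier_vec k"
    have "scalar_prod x (B *\<^sub>v x) = (\<Sum>i<k. \<Sum>j<k. \<Sum>v\<leftarrow>vs. (vec_index v i * vec_index x i) * (vec_index v j * vec_index x j))"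
      unfolding quadratic_form_as_sum[OF cB x x] using vs(2)
      by (intro sum.cong refl) (simp add: sum_list_const_mult[symmetric] sum_list_mult_const[symmetric] mult_ac)
    also have "\<dots> = (\<Sum>v\<leftarrow>vs. (\<Sum>i<k. vec_index v i * vec_index x i)\<^sup>2)"
      by (simp add: sum_sum_list_swap power2_eq_square sum_product)
    also have "\<dots> = (\<Sum>v\<leftarrow>vs. (scalar_prod v x)\<^sup>2)"
      using vs(1) x by (intro arg_cong[of _ _ sum_list] map_cong refl)
        (auto simp: scalar_prod_def atLeast0LessThan)
    finally show "scalar_prod x (B *\<^sub>v x) = (\<Sum>v\<leftarrow>vs. (scalar_prod v x)\<^sup>2)" .
  qed
qed

lemma sum_list_nonneg_eq_0:
  fixes f :: "'b \<Rightarrow> real"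
  assumes "\<And>v. v \<in> set vs \<Longrightarrow> f v \<ge> 0" "(\<Sum>v\<leftarrow>vs. f v) = 0" "v \<in> set vs"
  shows "f v = 0"
  using assms sum_list_nonneg_eq_0_iff[of "map f vs"] by auto

text \<open>The inner product is a sum of nonnegative terms \<open>v^T A v\<close>. All of them
  vanish, so \<open>A\<close> annihilates every \<open>v\<close> and hence \<open>B\<close>.\<close>

lemma psd_mult_eq_0_if_mat_inner_eq_0:
  assumes A: "A \<in> psd_cone k" and B: "B \<in> psd_cone k" and "mat_inner A B = 0"
  shows "A * B = 0\<^sub>m k k"
proof -
  note cA = psd_coneD(1)[OF A]
  obtain vs where vs: "set vs \<subseteq> carrier_vec k"
    "mat_inner A B = (\<Sum>v\<leftarrow>vs. scalar_prod v (A *\<^sub>v v))"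
    "(\<And>v. v \<in> set vs \<Longrightarrow> A *\<^sub>v v = 0\<^sub>v k) \<Longrightarrow> A * B = 0\<^sub>m k k"
    using psd_rank_one_decompositionE[OF B] cA by metis
  have "scalar_prod v (A *\<^sub>v v) = 0" if "v \<in> set vs" for v
    using sum_list_nonneg_eq_0[of vs "\<lambda>v. scalar_prod v (A *\<^sub>v v)" v] that vs(1,2) assms(3)
      psd_coneD(3)[OF A] by auto
  then show ?thesis
    using vs(1,3) psd_mult_vec_eq_0[OF A] by blast
qed

section \<open>Domination between psd matrices with nested kernels\<close>

text \<open>The last hypothesis says that \<open>w\<close> lies in the span of \<open>vs\<close>.
  Instead of choosing coefficients, the induction eliminates one vector \<open>v\<close> of the list
  at a time.\<close>

lemma square_bounded_by_sum_squares:
  fixes w :: "real Matrix.vec"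
  assumes "set vs \<subseteq> carrier_vec k" "w \<in> carrier_vec k"
    and "\<And>x. x \<in> carrier_vec k \<Longrightarrow> (\<And>v. v \<in> set vs \<Longrightarrow> scalar_prod v x = 0) \<Longrightarrow> scalar_prod w x = 0"
  shows "\<exists>c\<ge>0. \<forall>x\<in>carrier_vec k. (scalar_prod w x)\<^sup>2 \<le> c * (\<Sum>v\<leftarrow>vs. (scalar_prod v x)\<^sup>2)"
  using assms
proof (induction vs arbitrary: w)
  case Nil
  then show ?case
    by (intro exI[of _ 0]) auto
next
  case (Cons v vs)
  have v: "v \<in> carrier_vec k" and vs: "set vs \<subseteq> carrier_vec k" and w: "w \<in> carrier_vec k"
    using Cons.prems by auto
  have nonneg: "(\<Sum>u\<leftarrow>vs. (scalar_prod u x)\<^sup>2) \<ge> 0" for x :: "real Matrix.vec"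
    by (intro sum_list_nonneg) auto
  show ?case
  proof (cases "\<forall>x\<in>carrier_vec k. (\<forall>u\<in>set vs. scalar_prod u x = 0) \<longrightarrow> scalar_prod w x = 0")
    case True
    then obtain c where c: "c \<ge> 0"
        "\<forall>x\<in>carrier_vec k. (scalar_prod w x)\<^sup>2 \<le> c * (\<Sum>v\<leftarrow>vs. (scalar_prod v x)\<^sup>2)"
      using Cons.IH[OF vs w] by blast
    have "(scalar_prod w x)\<^sup>2 \<le> c * (\<Sum>v\<leftarrow>v # vs. (scalar_prod v x)\<^sup>2)" if "x \<in> carrier_vec k" for x
      using c that by (simp add: distrib_left add_increasing)
    then show ?thesis
      using c(1) by blast
  next
    case False
    then obtain y where y: "y \<in> carrier_vec k" "\<And>u. u \<in> set vs \<Longrightarrow> scalar_prod u y = 0"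
        "scalar_prod w y \<noteq> 0"
      by blast
    then have vy: "scalar_prod v y \<noteq> 0"
      using Cons.prems(3)[OF y(1)] by auto
    \<comment> \<open>Chosen such that \<open>w' = w - a v\<close> is orthogonal to
      \<open>y\<close>.\<close>
    define a where "a = scalar_prod w y / scalar_prod v y"
    define w' where "w' = w + (- a) \<cdot>\<^sub>v v"
    have w': "w' \<in> carrier_vec k"
      using v w by (simp add: w'_def)
    have w'x: "scalar_prod w' x = scalar_prod w x - a * scalar_prod v x" if "x \<in> carrier_vec k" for x
      using that v w by (simp add: w'_def add_scalar_prod_distrib[of _ k])
    have "scalar_prod w' x = 0"
      if x: "x \<in> carrier_vec k" "\<And>u. u \<in> set vs \<Longrightarrow> scalar_prod u x = 0" for x
    proof -
      \<comment> \<open>Makes \<open>x - b y\<close> orthogonal to \<open>v\<close> as well, so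
        \<open>w\<close> vanishes on it; by the choice of \<open>a\<close> this value is
        \<open>scalar_prod w' x\<close>.\<close>
      define b where "b = scalar_prod v x / scalar_prod v y"
      have sub: "scalar_prod u (x + (- b) \<cdot>\<^sub>v y) = scalar_prod u x - b * scalar_prod u y"
        if "u \<in> carrier_vec k" for u
        using that x(1) y(1) by (simp add: scalar_prod_add_distrib[of _ k])
      have "scalar_prod w (x + (- b) \<cdot>\<^sub>v y) = 0"
      proof (rule Cons.prems(3))
        fix u assume "u \<in> set (v # vs)"
        then show "scalar_prod u (x + (- b) \<cdot>\<^sub>v y) = 0"
          using sub[of u] x(2) y(2) v vs vy by (auto simp: b_def)
      qed (use x(1) y(1) in auto)
      then show ?thesis
        using sub[OF w] w'x[OF x(1)] by (simp add: a_def b_def)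
    qed
    then obtain c where c: "c \<ge> 0"
        "\<forall>x\<in>carrier_vec k. (scalar_prod w' x)\<^sup>2 \<le> c * (\<Sum>v\<leftarrow>vs. (scalar_prod v x)\<^sup>2)"
      using Cons.IH[OF vs w'] by blast
    \<comment> \<open>The constant comes from \<open>(p + a q)^2 <= 2 p^2 + 2 a^2 q^2\<close>, with
      \<open>c\<close> bounding \<open>p^2\<close>.\<close>
    have "(scalar_prod w x)\<^sup>2 \<le> (2 * c + 2 * a\<^sup>2) * (\<Sum>v\<leftarrow>v # vs. (scalar_prod v x)\<^sup>2)"
      if x: "x \<in> carrier_vec k" for x
    proof -
      let ?S = "\<Sum>v\<leftarrow>vs. (scalar_prod v x)\<^sup>2" and ?p = "scalar_prod w' x" and ?q = "scalar_prod v x"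
      have "(scalar_prod w x)\<^sup>2 = (?p + a * ?q)\<^sup>2"
        using w'x[OF x] by simp
      also have "\<dots> \<le> 2 * ?p\<^sup>2 + 2 * (a * ?q)\<^sup>2"
        using zero_le_power2[of "?p - a * ?q"] by (simp add: power2_eq_square algebra_simps)
      also have "\<dots> \<le> 2 * (c * ?S) + 2 * a\<^sup>2 * ?q\<^sup>2"
        using c(2) x by (simp add: power_mult_distrib)
      also have "\<dots> \<le> (2 * c + 2 * a\<^sup>2) * (?q\<^sup>2 + ?S)"
        using c(1) nonneg[of x] by (simp add: algebra_simps)
      finally show ?thesis
        by simp
    qed
    then show ?thesis
      using c(1) by (intro exI[of _ "2 * c + 2 * a\<^sup>2"]) auto
  qed
qed

text \<open>Both forms are sums of squares. Where all squares of \<open>A\<close> vanish,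
  \<open>x\<close> is in the kernel of \<open>A\<close>, hence of \<open>B\<close>, so all squares
  of \<open>B\<close> vanish too. Each of these is therefore bounded by a multiple of the form of
  \<open>A\<close>, and the bounds are added.\<close>

lemma psd_dominated_if_mat_kernel_subset:
  assumes A: "A \<in> psd_cone k" and B: "B \<in> psd_cone k" and ker: "mat_kernel A \<subseteq> mat_kernel B"
  shows "\<exists>c\<ge>0. \<forall>x\<in>carrier_vec k. scalar_prod x (B *\<^sub>v x) \<le> c * scalar_prod x (A *\<^sub>v x)"
proof -
  note cA = psd_coneD(1)[OF A] and cB = psd_coneD(1)[OF B]
  obtain vs where vs: "set vs \<subseteq> carrier_vec k"
      "\<And>x. x \<in> carrier_vec k \<Longrightarrow> scalar_prod x (A *\<^sub>v x) = (\<Sum>v\<leftarrow>vs. (scalar_prod v x)\<^sup>2)"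
    using psd_rank_one_decompositionE[OF A] by metis
  obtain ws where ws: "set ws \<subseteq> carrier_vec k"
      "\<And>x. x \<in> carrier_vec k \<Longrightarrow> scalar_prod x (B *\<^sub>v x) = (\<Sum>w\<leftarrow>ws. (scalar_prod w x)\<^sup>2)"
    using psd_rank_one_decompositionE[OF B] by metis
  have "scalar_prod w x = 0"
    if w: "w \<in> set ws" and x: "x \<in> carrier_vec k" "\<And>v. v \<in> set vs \<Longrightarrow> scalar_prod v x = 0" for w x
  proof -
    have "(\<Sum>v\<leftarrow>vs. (scalar_prod v x)\<^sup>2) = (\<Sum>v\<leftarrow>vs. 0)"
      using x(2) by (intro arg_cong[of _ _ sum_list] map_cong) auto
    then have "A *\<^sub>v x = 0\<^sub>v k"
      using psd_mult_vec_eq_0[OF A x(1)] vs(2)[OF x(1)] by simp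
    then have "B *\<^sub>v x = 0\<^sub>v k"
      using ker mat_kernelI[OF cA x(1)] mat_kernelD[OF cB] by blast
    then have "(\<Sum>w\<leftarrow>ws. (scalar_prod w x)\<^sup>2) = 0"
      using ws(2)[OF x(1)] x(1) by simp
    then show ?thesis
      using sum_list_nonneg_eq_0[of ws "\<lambda>w. (scalar_prod w x)\<^sup>2" w] w by simp
  qed
  then have bound: "\<exists>c\<ge>0. \<forall>x\<in>carrier_vec k. (scalar_prod w x)\<^sup>2 \<le> c * scalar_prod x (A *\<^sub>v x)"
    if "w \<in> set ws" for w
    using square_bounded_by_sum_squares[OF vs(1), of w] that ws(1) vs(2) by (metis subsetD)
  have "\<exists>c\<ge>0. \<forall>x\<in>carrier_vec k. (\<Sum>w\<leftarrow>us. (scalar_prod w x)\<^sup>2) \<le> c * scalar_prod x (A *\<^sub>v x)"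
    if "set us \<subseteq> set ws" for us
    using that
  proof (induction us)
    case (Cons u us)
    then obtain c where "c \<ge> 0"
      "\<forall>x\<in>carrier_vec k. (\<Sum>w\<leftarrow>us. (scalar_prod w x)\<^sup>2) \<le> c * scalar_prod x (A *\<^sub>v x)"
      by auto
    moreover obtain d where "d \<ge> 0"
      "\<forall>x\<in>carrier_vec k. (scalar_prod u x)\<^sup>2 \<le> d * scalar_prod x (A *\<^sub>v x)"
      using bound[of u] Cons.prems by auto
    ultimately show ?case
      by (intro exI[of _ "d + c"]) (auto simp: distrib_right intro: add_mono)
  qed auto
  from this[of ws] show ?thesis
    using ws(2) by auto
qed

text \<open>The segment from \<open>B\<close> to \<open>A\<close> can be prolonged beyond
  \<open>A\<close> inside the cone, because the form of \<open>B\<close> is at most \<open>c\<close>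
  times that of \<open>A\<close>.\<close>

lemma psd_extension_if_mat_kernel_subset:
  assumes A: "A \<in> psd_cone k" and B: "B \<in> psd_cone k" and ker: "mat_kernel A \<subseteq> mat_kernel B"
  shows "\<exists>e>0. (1 + e) \<cdot>\<^sub>m A + (- e) \<cdot>\<^sub>m B \<in> psd_cone k"
proof -
  note cA = psd_coneD(1)[OF A] and cB = psd_coneD(1)[OF B]
  obtain c where c: "c \<ge> 0"
      "\<forall>x\<in>carrier_vec k. scalar_prod x (B *\<^sub>v x) \<le> c * scalar_prod x (A *\<^sub>v x)"
    using psd_dominated_if_mat_kernel_subset[OF assms] by blast
  \<comment> \<open>Positive also for \<open>c = 0\<close>, and small enough that
    \<open>e * c <= 1\<close>.\<close>
  define e where "e = 1 / (1 + c)"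
  have e: "e > 0" "e * c \<le> 1"
    using c(1) by (auto simp: e_def field_simps)
  have "(1 + e) * scalar_prod x (A *\<^sub>v x) + (- e) * scalar_prod x (B *\<^sub>v x) \<ge> 0"
    if x: "x \<in> carrier_vec k" for x
  proof -
    have "e * scalar_prod x (B *\<^sub>v x) \<le> e * (c * scalar_prod x (A *\<^sub>v x))"
      using c(2) x e(1) by (intro mult_left_mono) auto
    also have "\<dots> \<le> 1 * scalar_prod x (A *\<^sub>v x)"
      using e(2) psd_coneD(3)[OF A x] unfolding mult.assoc[symmetric] by (intro mult_right_mono) auto
    also have "\<dots> \<le> (1 + e) * scalar_prod x (A *\<^sub>v x)"
      using e(1) psd_coneD(3)[OF A x] by (intro mult_right_mono) auto
    finally show ?thesis
      by simp
  qed
  then have "(1 + e) \<cdot>\<^sub>m A + (- e) \<cdot>\<^sub>m B \<in> psd_cone k"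
    using sym_mats_combination[of A k B "1 + e" "- e"] A B quadratic_form_combination[OF cA cB]
    by (auto simp: psd_cone_def)
  then show ?thesis
    using e(1) by blast
qed

section \<open>Faces of polytopes\<close>

text \<open>With \<open>z\<close> the far end point, \<open>x = (e y + z) / (1 + e)\<close>.\<close>

lemma in_open_segment_extension:
  fixes x y :: "'a :: real_vector"
  assumes "x \<noteq> y" "e > 0"
  shows "x \<in> open_segment y (x + e *\<^sub>R (x - y))"
proof -
  have "x = (1 - 1 / (1 + e)) *\<^sub>R y + (1 / (1 + e)) *\<^sub>R (x + e *\<^sub>R (x - y))"
  proof -
    have "(1 - 1 / (1 + e)) *\<^sub>R y + (1 / (1 + e)) *\<^sub>R (x + e *\<^sub>R (x - y))
        = (1 - 1 / (1 + e) - e / (1 + e)) *\<^sub>R y + ((1 + e) / (1 + e)) *\<^sub>R x"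
      by (simp only: add_divide_distrib) (simp add: algebra_simps)
    moreover have "1 - 1 / (1 + e) - e / (1 + e) = 0" "(1 + e) / (1 + e) = 1"
      using assms(2) by (auto simp: field_simps)
    ultimately show ?thesis
      by simp
  qed
  moreover have "y \<noteq> x + e *\<^sub>R (x - y)"
  proof
    assume "y = x + e *\<^sub>R (x - y)"
    then have "(1 + e) *\<^sub>R (x - y) = 0"
      by (simp add: algebra_simps)
    then show False
      using assms by simp
  qed
  ultimately show ?thesis
    using assms unfolding in_segment by (intro conjI exI[of _ "1 / (1 + e)"]) auto
qed

text \<open>The form in which faces are used below: if the segment from \<open>y\<close> to a point
  \<open>x\<close> of the face can be prolonged inside \<open>P\<close>, then \<open>x\<close> is
  interior to a segment of \<open>P\<close> starting at \<open>y\<close>.\<close>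

lemma face_of_extension:
  assumes "F face_of P" "x \<in> F" "y \<in> P" "e > 0" "x + e *\<^sub>R (x - y) \<in> P"
  shows "y \<in> F"
  using assms in_open_segment_extension[of x y e] unfolding face_of_def by blast

text \<open>Descend from \<open>Q\<close> to a facet of \<open>Q\<close> containing \<open>p\<close>
  until only \<open>{p}\<close> is left; each facet lowers the dimension by one. In the applications
  \<open>R F m\<close> asserts a psd matrix of rank at least \<open>m\<close> attached to
  \<open>F\<close>.\<close>

lemma face_flag_induct:
  fixes P :: "'a :: euclidean_space set"
  assumes P: "polytope P" and p: "p extreme_point_of P" and base: "R {p} m"
    and step: "\<And>F G m. F face_of P \<Longrightarrow> G face_of P \<Longrightarrow> F \<noteq> {} \<Longrightarrow> F \<subset> G \<Longrightarrow> R F m \<Longrightarrow> R G (Suc m)"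
    and Q: "Q face_of P" "p \<in> Q"
  shows "R Q (m + nat (aff_dim Q))"
  using Q
proof (induction "nat (aff_dim Q)" arbitrary: Q rule: less_induct)
  case less
  show ?case
  proof (cases "Q = {p}")
    case True
    then show ?thesis
      using base by simp
  next
    case False
    have "polyhedron Q"
      using face_of_polytope_polytope[OF P] less.prems(1) polytope_imp_polyhedron by blast
    moreover have "{p} face_of Q"
      using p less.prems by (simp add: face_of_singleton extreme_point_of_face)
    ultimately obtain F where F: "F facet_of Q" "{p} \<subseteq> F"
      using face_of_polyhedron_subset_facet False by blast
    have FQ: "F face_of Q" "F \<subset> Q" and dim: "aff_dim F = aff_dim Q - 1" "F \<noteq> {}"
      using F(1) facet_of_irrefl[of Q] by (auto simp: facet_of_def dest: face_of_imp_subset)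
    \<comment> \<open>Nonemptiness keeps the dimension from being -1, so that \<open>nat\<close>
      does not truncate.\<close>
    have "aff_dim F \<ge> 0"
      using dim(2) aff_dim_empty[of F] aff_dim_geq[of F] by linarith
    then have nat: "nat (aff_dim Q) = Suc (nat (aff_dim F))"
      using dim by simp
    have FP: "F face_of P"
      using face_of_trans[OF FQ(1) less.prems(1)] .
    have "R F (m + nat (aff_dim F))"
      using less.hyps[of F] nat FP F(2) by simp
    then have "R Q (Suc (m + nat (aff_dim F)))"
      using step[OF FP less.prems(1) dim(2) FQ(2)] by blast
    then show ?thesis
      using nat by simp
  qed
qed

section \<open>Tight inequalities, vertices and facets\<close>

text \<open>Otherwise every inequality tight on \<open>F\<close> is tight at \<open>y\<close>. A
  point \<open>x\<close> of \<open>F\<close> where the remaining inequalities are strict can then be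
  moved a little away from \<open>y\<close> without leaving \<open>P\<close>, which puts
  \<open>y\<close> into \<open>F\<close>.\<close>

lemma face_of_polyhedron_separating_inequality:
  fixes P :: "'a :: euclidean_space set" and f :: nat
  assumes P: "P = {x. \<forall>j < f. \<beta> j - inner (a j) x \<ge> 0}"
    and F: "F face_of P" "F \<noteq> {}" and y: "y \<in> P" "y \<notin> F"
  shows "\<exists>j < f. (\<forall>x\<in>F. \<beta> j - inner (a j) x = 0) \<and> \<beta> j - inner (a j) y > 0"
proof (rule ccontr)
  define s where "s j x = \<beta> j - inner (a j) x" for j :: nat and x
  assume "\<not> ?thesis"
  then have tight: "s j y = 0" if "j < f" "\<forall>x\<in>F. s j x = 0" for j
    using that y(1) unfolding P s_def by (auto simp: less_le)
  define J where "J = {j. j < f \<and> \<not> (\<forall>x\<in>F. s j x = 0)}"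
  have s_nonneg: "s j x \<ge> 0" if "x \<in> F" "j < f" for j x
    using that face_of_imp_subset[OF F(1)] unfolding P s_def by auto
  have "finite J"
    unfolding J_def by simp
  \<comment> \<open>Midpoints collect strict inequalities one by one: slacks are affine and
    nonnegative on \<open>F\<close>.\<close>
  have interior: "\<exists>x\<in>F. \<forall>j\<in>I. s j x > 0" if "finite I" "I \<subseteq> J" for I
    using that
  proof (induction I rule: finite_induct)
    case empty
    then show ?case
      using F(2) by auto
  next
    case (insert i I)
    then obtain x where x: "x \<in> F" "\<forall>j\<in>I. s j x > 0"
      by auto
    have "i \<in> J"
      using insert.prems by simp
    then obtain z where z: "z \<in> F" "s i z \<noteq> 0" and "i < f"
      unfolding J_def by blast
    then have "s i z > 0"
      using s_nonneg[of z i] by simp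
    have mid: "s j ((1/2) *\<^sub>R x + (1/2) *\<^sub>R z) = (s j x + s j z) / 2" for j
      by (simp add: s_def inner_add_right field_simps)
    have "(1/2) *\<^sub>R x + (1/2) *\<^sub>R z \<in> F"
      using face_of_imp_convex[OF F(1)] x(1) z(1) by (auto simp: convex_def)
    moreover have "s j x + s j z > 0" if "j \<in> insert i I" for j
    proof (cases "j = i")
      case True
      then show ?thesis
        using \<open>s i z > 0\<close> s_nonneg[OF x(1), of i] insert.prems by (auto simp: J_def)
    next
      case False
      then show ?thesis
        using that x s_nonneg[OF z(1), of j] insert.prems by (auto simp: J_def intro: add_pos_nonneg)
    qed
    ultimately show ?case
      by (intro bexI[of _ "(1/2) *\<^sub>R x + (1/2) *\<^sub>R z"]) (auto simp only: mid half_gt_zero_iff)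
  qed
  obtain x where x: "x \<in> F" "\<And>j. j \<in> J \<Longrightarrow> s j x > 0"
    using interior[OF \<open>finite J\<close> order_refl] by blast
  \<comment> \<open>Finitely many strict inequalities survive a small enough step
    \<open>e\<close>.\<close>
  have "\<forall>\<^sub>F e in at_right 0. \<forall>j\<in>J. s j x - e * s j y > 0"
    using \<open>finite J\<close>
  proof (intro eventually_ball_finite ballI)
    fix j assume "j \<in> J"
    have "((\<lambda>e. s j x - e * s j y) \<longlongrightarrow> s j x - 0 * s j y) (at_right 0)"
      by (intro tendsto_intros)
    then show "\<forall>\<^sub>F e in at_right 0. s j x - e * s j y > 0"
      using x(2)[OF \<open>j \<in> J\<close>] by (intro order_tendstoD(1)) auto
  qed
  with eventually_at_right_less
  have "\<forall>\<^sub>F e in at_right (0::real). 0 < e \<and> (\<forall>j\<in>J. s j x - e * s j y > 0)"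
    by (rule eventually_conj)
  then have "\<exists>e>0. \<forall>j\<in>J. s j x - e * s j y > 0"
    using eventually_happens'[OF trivial_limit_at_right_real] by blast
  then obtain e where e: "e > 0" "\<And>j. j \<in> J \<Longrightarrow> s j x - e * s j y > 0"
    by blast
  have "s j (x + e *\<^sub>R (x - y)) \<ge> 0" if "j < f" for j
  proof -
    have eq: "s j (x + e *\<^sub>R (x - y)) = s j x + e * (s j x - s j y)"
      by (simp add: s_def algebra_simps)
    show ?thesis
    proof (cases "j \<in> J")
      case True
      then have "e * s j x \<ge> 0"
        using e(1) x(2) by (simp add: less_imp_le)
      then show ?thesis
        using e(2)[OF True] unfolding eq by (simp add: algebra_simps)
    next
      case False
      then have "s j x = 0" "s j y = 0"
        using that x(1) tight unfolding J_def by auto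
      then show ?thesis
        unfolding eq by simp
    qed
  qed
  then have "x + e *\<^sub>R (x - y) \<in> P"
    unfolding P s_def by simp
  then show False
    using face_of_extension[OF F(1) x(1) y(1) e(1)] y(2) by simp
qed

text \<open>The inequality separating some point of \<open>G\<close> from \<open>F\<close> is also
  strict at a vertex of \<open>G\<close>: if all vertices of \<open>G\<close> lay on its hyperplane,
  so would their hull \<open>G\<close>. Vertices of \<open>G\<close> are vertices of
  \<open>P\<close>.\<close>

lemma faces_of_polytope_separating_vertex:
  fixes P :: "'a :: euclidean_space set" and f :: nat
  assumes P: "P = {x. \<forall>j < f. \<beta> j - inner (a j) x \<ge> 0}" and "polytope P"
    and F: "F face_of P" "F \<noteq> {}" and G: "G face_of P" "F \<subset> G"
  obtains j q where "j < f" "\<And>x. x \<in> F \<Longrightarrow> \<beta> j - inner (a j) x = 0"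
    "q extreme_point_of P" "q \<in> G" "\<beta> j - inner (a j) q \<noteq> 0"
proof -
  obtain y where y: "y \<in> G" "y \<notin> F"
    using G(2) by blast
  then have "y \<in> P"
    using G(1) face_of_imp_subset by blast
  then obtain j where j: "j < f" "\<And>x. x \<in> F \<Longrightarrow> \<beta> j - inner (a j) x = 0"
      "\<beta> j - inner (a j) y > 0"
    using face_of_polyhedron_separating_inequality[OF P F] y(2) by blast
  have "polytope G"
    using face_of_polytope_polytope[OF \<open>polytope P\<close> G(1)] .
  then have hull: "G = convex hull {x. x extreme_point_of G}"
    using Krein_Milman_Minkowski polytope_imp_compact polytope_imp_convex by blast
  have "\<not> {x. x extreme_point_of G} \<subseteq> {x. inner (a j) x = \<beta> j}"
  proof
    assume "{x. x extreme_point_of G} \<subseteq> {x. inner (a j) x = \<beta> j}"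
    then have "G \<subseteq> {x. inner (a j) x = \<beta> j}"
      using hull_minimal convex_hyperplane by (subst hull) blast
    then show False
      using y(1) j(3) by auto
  qed
  then obtain q where "q extreme_point_of G" "inner (a j) q \<noteq> \<beta> j"
    by blast
  then show thesis
    using that[OF j(1,2), of q] extreme_point_of_face[OF G(1)] by simp
qed

text \<open>Reduces to \<open>facet_of_polyhedron_explicit\<close>, which speaks of a set of
  half-spaces rather than an indexed family. Irredundancy makes the indexing injective and the
  normals nonzero; full dimension makes the affine hull everything.\<close>

lemma irredundant_representation_facet_of:
  fixes P :: "(real ^ 'n) set"
  assumes irr: "irredundant_representation P f a \<beta>" and "aff_dim P = int CARD('n)" and j: "j < f"
  shows "P \<inter> {x. inner (a j) x = \<beta> j} facet_of P"
proof -
  define H where "H i = {x. inner (a i) x \<le> \<beta> i}" for i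
  have P: "P = (\<Inter>i<f. H i)"
  proof -
    have "P = {x. \<forall>i<f. \<beta> i - inner (a i) x \<ge> 0}"
      using irr unfolding irredundant_representation_def by (rule conjunct1)
    also have "\<dots> = (\<Inter>i<f. H i)"
      unfolding H_def by auto
    finally show ?thesis .
  qed
  have min: "P \<noteq> (\<Inter>k\<in>{..<f} - {i}. H k)" if "i < f" for i
  proof -
    have "(\<Inter>k\<in>{..<f} - {i}. H k) = {x. \<forall>j < f. j \<noteq> i \<longrightarrow> \<beta> j - inner (a j) x \<ge> 0}"
      unfolding H_def by auto
    then show ?thesis
      using irr that unfolding irredundant_representation_def by (metis (no_types, lifting))
  qed
  have min': "\<not> (\<Inter>i\<in>{..<f} - {i}. H i) \<subseteq> H i" if "i < f" for i
  proof
    assume "(\<Inter>i\<in>{..<f} - {i}. H i) \<subseteq> H i"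
    then have "(\<Inter>i\<in>{..<f} - {i}. H i) = P"
      unfolding P by blast
    then show False
      using min[OF that] by simp
  qed
  \<comment> \<open>If two indices gave the same half-space, either could be dropped.\<close>
  have inj: "inj_on H {..<f}"
  proof (rule inj_onI, rule ccontr)
    fix i k assume "i \<in> {..<f}" "k \<in> {..<f}" "H i = H k" "i \<noteq> k"
    then show False
      using min'[of i] by blast
  qed
  have "P \<noteq> {}"
    using assms(2) by auto
  have a0: "a i \<noteq> 0" if "i < f" for i
  proof
    assume "a i = 0"
    moreover have "P \<subseteq> H i"
      unfolding P using that by blast
    ultimately have "H i = UNIV"
      using \<open>P \<noteq> {}\<close> unfolding H_def by auto
    then show False
      using min'[OF that] by simp
  qed
  have affP: "affine hull P = UNIV"
    using assms(2) aff_dim_eq_full[of P] by simp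
  \<comment> \<open>Recovers the index of a half-space.\<close>
  define g where "g h = inv_into {..<f} H h" for h
  have g: "g (H i) = i" if "i < f" for i
    using that inj unfolding g_def by simp
  have "P \<inter> {x. inner (a j) x = \<beta> j} facet_of P \<longleftrightarrow>
    (\<exists>h. h \<in> H ` {..<f} \<and> P \<inter> {x. inner (a j) x = \<beta> j} = P \<inter> {x. inner (a (g h)) x = \<beta> (g h)})"
  proof (rule facet_of_polyhedron_explicit)
    show "P = affine hull P \<inter> \<Inter> (H ` {..<f})"
      unfolding affP by (simp add: P)
    show "a (g h) \<noteq> 0 \<and> h = {x. inner (a (g h)) x \<le> \<beta> (g h)}" if "h \<in> H ` {..<f}" for h
    proof -
      obtain i where i: "i < f" "h = H i"
        using \<open>h \<in> H ` {..<f}\<close> by blast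
      then have "g h = i"
        using g by simp
      then show ?thesis
        using a0[OF i(1)] i(2) H_def by simp
    qed
    show "P \<subset> affine hull P \<inter> \<Inter> F'" if "F' \<subset> H ` {..<f}" for F'
    proof -
      obtain i where i: "i < f" "H i \<notin> F'"
        using \<open>F' \<subset> H ` {..<f}\<close> by blast
      have "(\<Inter>i\<in>{..<f} - {i}. H i) \<subseteq> \<Inter> F'"
        using that i(2) by blast
      moreover have "P \<subseteq> H i"
        unfolding P using i(1) by blast
      ultimately have "\<not> \<Inter> F' \<subseteq> P"
        using min'[OF i(1)] by blast
      moreover have "P \<subseteq> \<Inter> F'"
        using that unfolding P by blast
      ultimately show ?thesis
        unfolding affP by blast
    qed
  qed simp
  moreover have "H j \<in> H ` {..<f}"
    using j by blast
  ultimately show ?thesis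
    using g[OF j] by metis
qed

section \<open>Psd lifts and psd factorizations\<close>

text \<open>The kernel of the combination lies in both kernels, hence properly in that of
  \<open>A\<close>.\<close>

lemma rank_psd_combination_less:
  assumes A: "A \<in> psd_cone k" and B: "B \<in> psd_cone k" and "s > 0" "t > 0"
    and ker: "\<not> mat_kernel A \<subseteq> mat_kernel B"
  shows "vec_space.rank k A < vec_space.rank k (s \<cdot>\<^sub>m A + t \<cdot>\<^sub>m B)"
proof (rule rank_less_if_mat_kernel_psubset)
  show "A \<in> carrier_mat k k" "s \<cdot>\<^sub>m A + t \<cdot>\<^sub>m B \<in> carrier_mat k k"
    using psd_coneD(1)[OF A] psd_coneD(1)[OF B] by auto
  show "mat_kernel (s \<cdot>\<^sub>m A + t \<cdot>\<^sub>m B) \<subset> mat_kernel A"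
    using mat_kernel_psd_combination[OF assms(1-4)] ker by blast
qed

lemma mat_inner_combination:
  assumes "A \<in> carrier_mat k k" "B \<in> carrier_mat k k" "C \<in> carrier_mat k k"
  shows "mat_inner (s \<cdot>\<^sub>m A + t \<cdot>\<^sub>m B) C = s * mat_inner A C + t * mat_inner B C"
  using assms
  by (simp add: mat_inner_def mat_trace_def scalar_prod_def sum.distrib sum_distrib_left
      algebra_simps)

lemma mat_inner_zero:
  assumes "C \<in> carrier_mat k k"
  shows "mat_inner (0\<^sub>m k k) C = 0" "mat_inner C (0\<^sub>m k k) = 0"
  using assms by (simp_all add: mat_inner_def mat_trace_def)

section \<open>Existence of psd lifts and the bound on their size\<close>

text \<open>Guarantees that the minimum defining \<open>psd_rank\<close> is attained. The diagonal
  of a matrix in the lift holds the coefficients of a convex combination of a finite set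
  \<open>V\<close> with hull \<open>P\<close>.\<close>

lemma polytope_has_psd_lift:
  fixes P :: "(real ^ 'n) set"
  assumes "polytope P" "P \<noteq> {}"
  shows "\<exists>k>0. \<exists>S. psd_lift k P S"
proof -
  obtain V where V: "finite V" "P = convex hull V"
    using assms(1) by (auto simp: polytope_def)
  define m where "m = card V"
  obtain p where p: "bij_betw p {..<m} V"
    using ex_bij_betw_nat_finite[OF V(1)] by (auto simp: m_def atLeast0LessThan)
  have "m > 0"
    using V assms(2) by (auto simp: m_def card_gt_0_iff)
  define L where "L = {A \<in> sym_mats m. (\<forall>i<m. \<forall>j<m. i \<noteq> j \<longrightarrow> A $$ (i, j) = 0) \<and> (\<Sum>i<m. A $$ (i, i)) = 1}"
  define \<pi> where "\<pi> A = (\<Sum>i<m. A $$ (i, i) *\<^sub>R p i)" for A :: "real Matrix.mat"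
  have carrier: "A \<in> carrier_mat m m" if "A \<in> sym_mats m" for A
    using that by (simp add: sym_mats_def)
  have "affine_sym_subspace m L"
    unfolding affine_sym_subspace_def
  proof (intro conjI ballI allI impI)
    show "L \<subseteq> sym_mats m"
      by (auto simp: L_def)
    fix A B and u v :: real assume A: "A \<in> L" and B: "B \<in> L" and uv: "u + v = 1"
    then have c: "A \<in> carrier_mat m m" "B \<in> carrier_mat m m"
      by (auto simp: L_def carrier)
    have "(\<Sum>i<m. u * A $$ (i, i) + v * B $$ (i, i)) = u * (\<Sum>i<m. A $$ (i, i)) + v * (\<Sum>i<m. B $$ (i, i))"
      by (simp add: sum.distrib sum_distrib_left)
    also have "\<dots> = 1"
      using A B uv by (simp add: L_def)
    finally show "u \<cdot>\<^sub>m A + v \<cdot>\<^sub>m B \<in> L"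
      using A B c sym_mats_combination[of A m B u v] by (auto simp: L_def)
  qed
  moreover have "linear_on_sym m \<pi>"
    unfolding linear_on_sym_def \<pi>_def
    by (auto dest!: carrier simp: scaleR_add_left sum.distrib scaleR_sum_right)
  moreover have "P = \<pi> ` (psd_cone m \<inter> L)"
  proof (rule subset_antisym; rule subsetI)
    fix x assume "x \<in> P"
    then obtain u where u: "\<forall>y\<in>V. 0 \<le> u y" "sum u V = 1" "(\<Sum>y\<in>V. u y *\<^sub>R y) = x"
      unfolding V(2) convex_hull_finite[OF V(1)] by auto
    define A where "A = Matrix.mat m m (\<lambda>(i, j). if i = j then u (p i) else 0)"
    have "transpose_mat A = A"
      by (auto simp: A_def intro!: eq_matI)
    then have "A \<in> sym_mats m"
      by (simp add: sym_mats_def A_def)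
    moreover have "(\<Sum>i<m. A $$ (i, i)) = 1" "\<pi> A = x"
      using u(2,3) sum.reindex_bij_betw[OF p, of u] sum.reindex_bij_betw[OF p, of "\<lambda>y. u y *\<^sub>R y"]
      by (simp_all add: A_def \<pi>_def)
    moreover have "scalar_prod y (A *\<^sub>v y) \<ge> 0" if y: "y \<in> carrier_vec m" for y
    proof -
      have "(\<Sum>i<m. \<Sum>j<m. vec_index y i * A $$ (i, j) * vec_index y j)
          = (\<Sum>i<m. u (p i) * (vec_index y i)\<^sup>2)"
        by (simp add: A_def if_distrib[of "\<lambda>c. _ * c"] if_distrib[of "\<lambda>c. c * _"] power2_eq_square
            mult_ac cong: if_cong)
      moreover have "u (p i) \<ge> 0" if "i < m" for i
        using u(1) p that by (auto simp: bij_betw_def)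
      ultimately show ?thesis
        using y by (subst quadratic_form_as_sum[of A m]) (auto simp: A_def intro!: sum_nonneg)
    qed
    ultimately have "A \<in> psd_cone m \<inter> L"
      by (auto simp: psd_cone_def L_def A_def)
    then show "x \<in> \<pi> ` (psd_cone m \<inter> L)"
      using \<open>\<pi> A = x\<close> by blast
  next
    fix x assume "x \<in> \<pi> ` (psd_cone m \<inter> L)"
    then obtain A where A: "A \<in> psd_cone m" "A \<in> L" and x: "x = \<pi> A"
      by blast
    have "p i \<in> convex hull V" if "i < m" for i
      using p that by (auto simp: bij_betw_def intro: hull_inc)
    then have "\<pi> A \<in> convex hull V"
      using A psd_diag(1)[OF A(1)] unfolding \<pi>_def
      by (intro convex_sum) (auto simp: L_def)
    then show "x \<in> P"
      using V(2) x by simp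
  qed
  ultimately show ?thesis
    using \<open>m > 0\<close> unfolding psd_lift_def by blast
qed

text \<open>\<open>face_flag_induct\<close> starts with rank 1 over a vertex and arrives at a matrix
  of rank at least \<open>1 + CARD('n)\<close>, whereas no rank exceeds \<open>k\<close>.\<close>

lemma dim_less_size_of_psd_lift:
  fixes P :: "(real ^ 'n) set"
  assumes P: "polytope P" "aff_dim P = int CARD('n)" and "psd_lift k P S"
  shows "CARD('n) + 1 \<le> k"
proof -
  obtain L \<pi> where L: "affine_sym_subspace k L" and \<pi>: "linear_on_sym k \<pi>"
    and S: "S = psd_cone k \<inter> L" and PS: "P = \<pi> ` S"
    using assms(3) unfolding psd_lift_def by blast
  have comb: "u \<cdot>\<^sub>m A + v \<cdot>\<^sub>m B \<in> L" if "A \<in> L" "B \<in> L" "u + v = 1" for A B u v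
    using L that unfolding affine_sym_subspace_def by blast
  have sym: "A \<in> sym_mats k" if "A \<in> L" for A
    using L that unfolding affine_sym_subspace_def by blast
  have smult: "c \<cdot>\<^sub>m A \<in> sym_mats k" if "A \<in> sym_mats k" for c A
  proof -
    have "c \<cdot>\<^sub>m A = c \<cdot>\<^sub>m A + 0 \<cdot>\<^sub>m A"
      using that by (auto simp: sym_mats_def intro!: eq_matI)
    then show ?thesis
      using sym_mats_combination[OF that that, of c 0] by simp
  qed
  have \<pi>_comb: "\<pi> (u \<cdot>\<^sub>m A + v \<cdot>\<^sub>m B) = u *\<^sub>R \<pi> A + v *\<^sub>R \<pi> B" if "A \<in> L" "B \<in> L" for A B u v
    using \<pi> smult sym[OF that(1)] sym[OF that(2)] unfolding linear_on_sym_def by simp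
  have "P \<noteq> {}"
    using P(2) by auto
  then obtain p where p: "p extreme_point_of P"
    using extreme_point_exists_convex polytope_imp_compact polytope_imp_convex P(1) by blast
  then have "p \<in> P"
    by (simp add: extreme_point_of_def)
  then obtain A0 where A0: "A0 \<in> S" "\<pi> A0 = p"
    using PS by blast
  have "A0 \<noteq> 0\<^sub>m k k"
  proof
    assume zero: "A0 = 0\<^sub>m k k"
    \<comment> \<open>Then \<open>S\<close> is a cone, so its image \<open>P\<close> is an unbounded cone with apex \<open>p\<close>.\<close>
    have "y = p" if "y \<in> P" for y
    proof (rule ccontr)
      assume "y \<noteq> p"
      obtain B where B: "B \<in> S" "\<pi> B = y"
        using \<open>y \<in> P\<close> PS by blast
      have "p + t *\<^sub>R (y - p) \<in> P" if "t \<ge> 0" for t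
      proof -
        have "t \<cdot>\<^sub>m B + (1 - t) \<cdot>\<^sub>m A0 = t \<cdot>\<^sub>m B + 0 \<cdot>\<^sub>m A0"
          using B A0 sym unfolding zero by (auto simp: S sym_mats_def intro!: eq_matI)
        then have "t \<cdot>\<^sub>m B + (1 - t) \<cdot>\<^sub>m A0 \<in> S"
          using comb[of B A0 t "1 - t"] psd_cone_combination[of B k A0 t 0] that B A0 by (auto simp: S)
        moreover have "\<pi> (t \<cdot>\<^sub>m B + (1 - t) \<cdot>\<^sub>m A0) = p + t *\<^sub>R (y - p)"
          using \<pi>_comb[of B A0 t "1 - t"] B A0 by (simp add: S algebra_simps)
        ultimately show ?thesis
          using PS by (metis image_eqI)
      qed
      moreover obtain M where M: "\<And>x. x \<in> P \<Longrightarrow> norm x \<le> M"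
        using polytope_imp_bounded[OF P(1)] by (auto simp: bounded_iff)
      moreover have "norm (t *\<^sub>R (y - p)) \<le> norm (p + t *\<^sub>R (y - p)) + norm p" for t
        using norm_triangle_ineq4[of "p + t *\<^sub>R (y - p)" p] by simp
      ultimately have bound: "t * norm (y - p) \<le> M + norm p" if "t \<ge> 0" for t
        using that by (smt (verit, ccfv_SIG) norm_scaleR abs_of_nonneg)
      have "M \<ge> 0"
        using M[OF \<open>p \<in> P\<close>] norm_ge_zero[of p] by linarith
      \<comment> \<open>This \<open>t\<close> is nonnegative and makes the left side of
        \<open>bound\<close> exceed its right side by one.\<close>
      then have "M + norm p + 1 \<le> M + norm p"
        using bound[of "(M + norm p + 1) / norm (y - p)"] \<open>y \<noteq> p\<close> by simp
      then show False
        by simp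
    qed
    then have "P = {p}"
      using \<open>p \<in> P\<close> by blast
    then show False
      using P(2) by simp
  qed
  then have "vec_space.rank k A0 > 0"
    using rank_pos_if_nonzero psd_coneD(1) A0 S by blast
  define R where "R F m \<longleftrightarrow> (\<exists>A\<in>S. \<pi> A \<in> F \<and> m \<le> vec_space.rank k A)" for F m
  have "R P (1 + nat (aff_dim P))"
  proof (rule face_flag_induct[OF P(1) p])
    show "R {p} 1"
      using A0 \<open>vec_space.rank k A0 > 0\<close> unfolding R_def by (intro bexI[of _ A0]) auto
    show "P face_of P"
      using polytope_imp_convex[OF P(1)] by (rule face_of_refl)
    fix F G m
    assume F: "F face_of P" and G: "G face_of P" and "F \<subset> G" and "R F m"
    then obtain A where A: "A \<in> S" "\<pi> A \<in> F" "m \<le> vec_space.rank k A"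
      unfolding R_def by blast
    obtain y where y: "y \<in> G" "y \<notin> F"
      using \<open>F \<subset> G\<close> by blast
    have "y \<in> P"
      using face_of_imp_subset[OF G] y(1) by blast
    then obtain B where B: "B \<in> S" "\<pi> B = y"
      using PS by blast
    have AB: "A \<in> psd_cone k" "B \<in> psd_cone k" "A \<in> L" "B \<in> L"
      using A(1) B(1) S by auto
    \<comment> \<open>Otherwise the segment from \<open>B\<close> to \<open>A\<close> could be
      prolonged inside \<open>S\<close>; its image prolongs the segment from \<open>y\<close> to a
      point of \<open>F\<close> inside \<open>P\<close>, which forces \<open>y\<close> into the
      face.\<close>
    have "\<not> mat_kernel A \<subseteq> mat_kernel B"
    proof
      assume "mat_kernel A \<subseteq> mat_kernel B"
      then obtain e where e: "e > 0" "(1 + e) \<cdot>\<^sub>m A + (- e) \<cdot>\<^sub>m B \<in> psd_cone k"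
        using psd_extension_if_mat_kernel_subset AB(1,2) by blast
      then have "(1 + e) \<cdot>\<^sub>m A + (- e) \<cdot>\<^sub>m B \<in> S"
        using comb[OF AB(3,4), of "1 + e" "- e"] S by simp
      moreover have "\<pi> ((1 + e) \<cdot>\<^sub>m A + (- e) \<cdot>\<^sub>m B) = \<pi> A + e *\<^sub>R (\<pi> A - y)"
        using \<pi>_comb[OF AB(3,4)] B(2) by (simp add: algebra_simps)
      ultimately have "\<pi> A + e *\<^sub>R (\<pi> A - y) \<in> P"
        using PS by (metis image_eqI)
      then show False
        using face_of_extension[OF F A(2) \<open>y \<in> P\<close> e(1)] y(2) by simp
    qed
    then have "vec_space.rank k A < vec_space.rank k ((1/2) \<cdot>\<^sub>m A + (1/2) \<cdot>\<^sub>m B)"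
      using rank_psd_combination_less[OF AB(1,2)] by simp
    moreover have "(1/2) \<cdot>\<^sub>m A + (1/2) \<cdot>\<^sub>m B \<in> S"
      using comb[OF AB(3,4)] psd_cone_combination[OF AB(1,2)] S by simp
    moreover have "\<pi> ((1/2) \<cdot>\<^sub>m A + (1/2) \<cdot>\<^sub>m B) \<in> G"
    proof -
      have "(1/2) *\<^sub>R \<pi> A + (1/2) *\<^sub>R y \<in> G"
        using face_of_imp_convex[OF G] A(2) y(1) \<open>F \<subset> G\<close> by (intro convexD) auto
      then show ?thesis
        using \<pi>_comb[OF AB(3,4)] B(2) by simp
    qed
    ultimately show "R G (Suc m)"
      using A(3) unfolding R_def by (intro bexI[of _ "(1/2) \<cdot>\<^sub>m A + (1/2) \<cdot>\<^sub>m B"]) auto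
  qed (use \<open>p \<in> P\<close> in simp)
  then obtain A where "A \<in> S" "1 + CARD('n) \<le> vec_space.rank k A"
    using P(2) unfolding R_def by auto
  moreover have "vec_space.rank k A \<le> k" if "A \<in> S" for A
    using vec_space.rank_le_nc psd_coneD(1) that S by blast
  ultimately show ?thesis
    by fastforce
qed

section \<open>Ranks of the factors of a slack matrix\<close>

context
  fixes P :: "(real ^ 'n) set" and a :: "nat \<Rightarrow> real ^ 'n" and \<beta> :: "nat \<Rightarrow> real"
    and p :: "nat \<Rightarrow> real ^ 'n" and f v k :: nat and A B :: "nat \<Rightarrow> real Matrix.mat"
  assumes P: "polytope P" "aff_dim P = int CARD('n)"
    and p: "p ` {..<v} = {x. x extreme_point_of P}"
    and irr: "irredundant_representation P f a \<beta>"
    and A: "\<And>i. i < v \<Longrightarrow> A i \<in> psd_cone k" and B: "\<And>j. j < f \<Longrightarrow> B j \<in> psd_cone k"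
    and inner: "\<And>i j. i < v \<Longrightarrow> j < f \<Longrightarrow> mat_inner (A i) (B j) = \<beta> j - inner (a j) (p i)"
begin

lemma polytope_eq_inequalities: "P = {x. \<forall>j<f. \<beta> j - inner (a j) x \<ge> 0}"
  using irr unfolding irredundant_representation_def by (rule conjunct1)

lemma polytope_vertexE:
  assumes "x extreme_point_of P"
  obtains i where "i < v" "p i = x"
  using assms p by (metis imageE lessThan_iff mem_Collect_eq)

text \<open>With \<open>Q = P\<close> the rank bound limits the vertex factors; with
  \<open>Q\<close> a facet, the orthogonality to the factor of that facet limits the latter.\<close>

lemma rank_along_flag:
  assumes i: "i < v" and Q: "Q face_of P" "p i \<in> Q"
  obtains C where "C \<in> psd_cone k" "vec_space.rank k (A i) + nat (aff_dim Q) \<le> vec_space.rank k C"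
    "\<And>j. j < f \<Longrightarrow> (\<And>x. x \<in> Q \<Longrightarrow> \<beta> j - inner (a j) x = 0) \<Longrightarrow> mat_inner C (B j) = 0"
proof -
  \<comment> \<open>The witness \<open>C\<close> is a sum of factors of vertices in \<open>F\<close>; only the orthogonality relations are kept.\<close>
  define R where "R F m \<longleftrightarrow> (\<exists>C\<in>psd_cone k. m \<le> vec_space.rank k C \<and>
    (\<forall>j<f. (\<forall>x\<in>F. \<beta> j - inner (a j) x = 0) \<longrightarrow> mat_inner C (B j) = 0))" for F m
  have ext: "p i extreme_point_of P"
    using p i by blast
  have "R Q (vec_space.rank k (A i) + nat (aff_dim Q))"
  proof (rule face_flag_induct[OF P(1) ext _ _ Q])
    show "R {p i} (vec_space.rank k (A i))"
      using A[OF i] inner[OF i] unfolding R_def by auto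
    fix F G m
    assume F: "F face_of P" "F \<noteq> {}" and G: "G face_of P" "F \<subset> G" and "R F m"
    then obtain C where C: "C \<in> psd_cone k" "m \<le> vec_space.rank k C"
      "\<And>j. j < f \<Longrightarrow> (\<And>x. x \<in> F \<Longrightarrow> \<beta> j - inner (a j) x = 0) \<Longrightarrow> mat_inner C (B j) = 0"
      unfolding R_def by blast
    obtain j q where j: "j < f" "\<And>x. x \<in> F \<Longrightarrow> \<beta> j - inner (a j) x = 0"
      and q: "q extreme_point_of P" "q \<in> G" "\<beta> j - inner (a j) q \<noteq> 0"
      using faces_of_polytope_separating_vertex[OF polytope_eq_inequalities P(1) F G] by blast
    obtain l where l: "l < v" "p l = q"
      using polytope_vertexE[OF q(1)] .
    note carr = psd_coneD(1)[OF C(1)] psd_coneD(1)[OF A[OF l(1)]] psd_coneD(1)[OF B[OF j(1)]]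
    have CB: "C * B j = 0\<^sub>m k k"
      using psd_mult_eq_0_if_mat_inner_eq_0[OF C(1) B[OF j(1)]] C(3)[OF j] by simp
    have "A l * B j \<noteq> 0\<^sub>m k k"
    proof
      assume "A l * B j = 0\<^sub>m k k"
      then have "mat_inner (A l) (B j) = 0"
        by (simp add: mat_inner_def mat_trace_def)
      then show False
        using inner[OF l(1) j(1)] l(2) q(3) by simp
    qed
    \<comment> \<open>The columns of \<open>B j\<close> lie in the kernel of \<open>C\<close>. If
      they were all in the kernel of \<open>A l\<close>, then \<open>A l * B j\<close> would vanish,
      but its trace is the nonzero slack at \<open>q\<close>.\<close>
    have "\<not> mat_kernel C \<subseteq> mat_kernel (A l)"
    proof
      assume sub: "mat_kernel C \<subseteq> mat_kernel (A l)"
      have "A l *\<^sub>v col (B j) s = 0\<^sub>v k" if "s < k" for s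
      proof -
        have "C *\<^sub>v col (B j) s = col (C * B j) s"
          using carr that by (intro eq_vecI) auto
        then have "col (B j) s \<in> mat_kernel C"
          using carr that CB by (intro mat_kernelI[of _ k k]) auto
        then show ?thesis
          using sub mat_kernelD(2)[OF carr(2)] by blast
      qed
      then have "(A l * B j) $$ (r, s) = 0" if "r < k" "s < k" for r s
        using carr that by (metis carrier_matD index_mult_mat(1) index_mult_mat_vec index_zero_vec(1))
      then have "A l * B j = 0\<^sub>m k k"
        using carr by (intro eq_matI) auto
      then show False
        using \<open>A l * B j \<noteq> 0\<^sub>m k k\<close> by simp
    qed
    then have "vec_space.rank k C < vec_space.rank k (1 \<cdot>\<^sub>m C + 1 \<cdot>\<^sub>m A l)"
      using rank_psd_combination_less[OF C(1) A[OF l(1)]] by simp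
    moreover have "1 \<cdot>\<^sub>m C + 1 \<cdot>\<^sub>m A l \<in> psd_cone k"
      using psd_cone_combination[OF C(1) A[OF l(1)]] by simp
    moreover have "mat_inner (1 \<cdot>\<^sub>m C + 1 \<cdot>\<^sub>m A l) (B j') = 0"
      if j': "j' < f" "\<And>x. x \<in> G \<Longrightarrow> \<beta> j' - inner (a j') x = 0" for j'
    proof -
      have "mat_inner C (B j') = 0"
        using C(3)[OF j'(1)] j'(2) G(2) by blast
      moreover have "mat_inner (A l) (B j') = 0"
        using inner[OF l(1) j'(1)] j'(2)[OF q(2)] l(2) by simp
      ultimately show ?thesis
        using mat_inner_combination[OF carr(1,2) psd_coneD(1)[OF B[OF j'(1)]], of 1 1] by simp
    qed
    ultimately show "R G (Suc m)"
      using C(2) unfolding R_def by (intro bexI[of _ "1 \<cdot>\<^sub>m C + 1 \<cdot>\<^sub>m A l"]) auto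
  qed
  then show thesis
    using that unfolding R_def by blast
qed

text \<open>A zero factor would make every slack at \<open>p i\<close> vanish. But \<open>P\<close>
  has another vertex \<open>q\<close>, and separating \<open>p i\<close> from the face
  \<open>{q}\<close> gives a positive slack.\<close>

lemma vertex_factor_nonzero:
  assumes i: "i < v"
  shows "A i \<noteq> 0\<^sub>m k k"
proof
  assume zero: "A i = 0\<^sub>m k k"
  have ext: "p i extreme_point_of P"
    using p i by blast
  have "P = convex hull {x. x extreme_point_of P}"
    using Krein_Milman_Minkowski polytope_imp_compact polytope_imp_convex P(1) by blast
  moreover have "P \<noteq> {p i}"
    using P(2) by auto
  ultimately have "{x. x extreme_point_of P} \<noteq> {p i}"
    by (metis convex_hull_singleton)
  then obtain q where q: "q extreme_point_of P" "q \<noteq> p i"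
    using ext by blast
  have "p i \<in> P"
    using ext by (simp add: extreme_point_of_def)
  then obtain j where "j < f" "\<beta> j - inner (a j) (p i) > 0"
    using face_of_polyhedron_separating_inequality[OF polytope_eq_inequalities, of "{q}" "p i"] q
    by (auto simp: face_of_singleton)
  then show False
    using inner[OF i, of j] mat_inner_zero(1)[OF psd_coneD(1)[OF B]] zero by simp
qed

text \<open>A zero factor would make inequality \<open>j\<close> tight at all vertices, hence on
  \<open>P\<close>, and \<open>P\<close> would be a facet of itself.\<close>

lemma facet_factor_nonzero:
  assumes j: "j < f"
  shows "B j \<noteq> 0\<^sub>m k k"
proof
  assume zero: "B j = 0\<^sub>m k k"
  have "\<beta> j - inner (a j) x = 0" if "x extreme_point_of P" for x
  proof -
    obtain i where i: "i < v" "p i = x"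
      using polytope_vertexE[OF \<open>x extreme_point_of P\<close>] .
    then show ?thesis
      using inner[OF i(1) j] mat_inner_zero(2)[OF psd_coneD(1)[OF A[OF i(1)]]] zero by simp
  qed
  then have "convex hull {x. x extreme_point_of P} \<subseteq> {x. inner (a j) x = \<beta> j}"
    by (intro hull_minimal convex_hyperplane) auto
  moreover have "P = convex hull {x. x extreme_point_of P}"
    using Krein_Milman_Minkowski polytope_imp_compact polytope_imp_convex P(1) by blast
  ultimately have "P \<inter> {x. inner (a j) x = \<beta> j} = P"
    by blast
  then show False
    using irredundant_representation_facet_of[OF irr P(2) j] facet_of_irrefl by metis
qed

text \<open>The flag up to \<open>P\<close> raises the rank by \<open>CARD('n)\<close>, which leaves
  room for an initial rank of at most 1 in size \<open>CARD('n) + 1\<close>.\<close>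

lemma rank_vertex_factor:
  assumes "k = CARD('n) + 1" and i: "i < v"
  shows "vec_space.rank k (A i) = 1"
proof -
  have ext: "p i extreme_point_of P"
    using p i by blast
  then have "p i \<in> P"
    by (simp add: extreme_point_of_def)
  then obtain C where "C \<in> psd_cone k" "vec_space.rank k (A i) + CARD('n) \<le> vec_space.rank k C"
    using rank_along_flag[OF i face_of_refl[OF polytope_imp_convex[OF P(1)]]] P(2) by auto
  then have "vec_space.rank k (A i) \<le> 1"
    using vec_space.rank_le_nc[OF psd_coneD(1), of C k] assms(1) by simp
  moreover have "vec_space.rank k (A i) > 0"
    using rank_pos_if_nonzero[OF psd_coneD(1)[OF A[OF i]] vertex_factor_nonzero[OF i]] .
  ultimately show ?thesis
    by simp
qed

text \<open>A flag from a vertex up to the facet ends with a matrix \<open>C\<close> of rank at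
  least \<open>CARD('n)\<close>. As \<open>C * B j = 0\<close>, the two ranks add up to at most
  \<open>CARD('n) + 1\<close>.\<close>

lemma rank_facet_factor:
  assumes k: "k = CARD('n) + 1" and j: "j < f"
  shows "vec_space.rank k (B j) = 1"
proof -
  define Q where "Q = P \<inter> {x. inner (a j) x = \<beta> j}"
  have facet: "Q facet_of P"
    unfolding Q_def by (rule irredundant_representation_facet_of[OF irr P(2) j])
  then have Q: "Q face_of P" "Q \<noteq> {}" "aff_dim Q = int CARD('n) - 1"
    using P(2) by (auto simp: facet_of_def)
  have "polytope Q"
    using face_of_polytope_polytope[OF P(1) Q(1)] .
  then obtain x where "x extreme_point_of Q"
    using extreme_point_exists_convex polytope_imp_compact polytope_imp_convex Q(2) by blast
  then have x: "x extreme_point_of P" "x \<in> Q"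
    using extreme_point_of_face[OF Q(1)] by auto
  obtain i where i: "i < v" "p i = x"
    using polytope_vertexE[OF x(1)] .
  then have "p i \<in> Q"
    using x(2) by simp
  obtain C where C: "C \<in> psd_cone k"
      "vec_space.rank k (A i) + nat (aff_dim Q) \<le> vec_space.rank k C" "mat_inner C (B j) = 0"
  proof -
    have "\<beta> j - inner (a j) y = 0" if "y \<in> Q" for y
      using that by (simp add: Q_def)
    then show thesis
      using rank_along_flag[OF i(1) Q(1) \<open>p i \<in> Q\<close>] that j by metis
  qed
  \<comment> \<open>Positivity keeps \<open>nat (CARD('n) - 1)\<close> from truncating; in dimension
    one the facet is a vertex and the flag has no steps.\<close>
  have "CARD('n) > 0"
    by simp
  then have "CARD('n) \<le> vec_space.rank k C"
    using C(2) Q(3) rank_vertex_factor[OF k i(1)] by linarith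
  moreover have "vec_space.rank k C + vec_space.rank k (B j) \<le> k"
    using rank_add_rank_le_if_mult_eq_0 psd_mult_eq_0_if_mat_inner_eq_0[OF C(1) B[OF j] C(3)]
      psd_coneD(1)[OF C(1)] psd_coneD(1)[OF B[OF j]] by blast
  moreover have "vec_space.rank k (B j) > 0"
    using rank_pos_if_nonzero[OF psd_coneD(1)[OF B[OF j]] facet_factor_nonzero[OF j]] .
  ultimately show ?thesis
    using k by simp
qed

end

theorem proposition3p2:
  fixes P :: "(real ^ 'n) set"
  assumes "polytope P" and "aff_dim P = int CARD('n)"
  shows "psd_rank P \<ge> CARD('n) + 1 \<and>
    (psd_rank P = CARD('n) + 1 \<longrightarrow>
      (\<forall>M A B. slack_matrix P M \<and> psd_factorization (CARD('n) + 1) M A B \<longrightarrow>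
        (\<forall>i < dim_row M. vec_space.rank (CARD('n) + 1) (A i) = 1) \<and>
        (\<forall>j < dim_col M. vec_space.rank (CARD('n) + 1) (B j) = 1)))"
proof (intro conjI impI allI)
  have "P \<noteq> {}"
    using assms(2) by auto
  then have "\<exists>k. k > 0 \<and> (\<exists>S. psd_lift k P S)"
    using polytope_has_psd_lift[OF assms(1)] by blast
  then have "psd_rank P > 0 \<and> (\<exists>S. psd_lift (psd_rank P) P S)"
    unfolding psd_rank_def by (rule LeastI_ex)
  then show "psd_rank P \<ge> CARD('n) + 1"
    using dim_less_size_of_psd_lift[OF assms] by blast
next
  fix M A B
  assume "slack_matrix P M \<and> psd_factorization (CARD('n) + 1) M A B"
  then obtain v f p a \<beta> where p: "bij_betw p {..<v} {x. x extreme_point_of P}"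
    and irr: "irredundant_representation P f a \<beta>"
    and M: "M = Matrix.mat v f (\<lambda>(i, j). \<beta> j - inner (a j) (p i))"
    and fac: "psd_factorization (CARD('n) + 1) M A B"
    unfolding slack_matrix_def by blast
  have A: "\<And>i. i < v \<Longrightarrow> A i \<in> psd_cone (CARD('n) + 1)"
    and B: "\<And>j. j < f \<Longrightarrow> B j \<in> psd_cone (CARD('n) + 1)"
    and inner: "\<And>i j. i < v \<Longrightarrow> j < f \<Longrightarrow> mat_inner (A i) (B j) = \<beta> j - inner (a j) (p i)"
    using fac unfolding psd_factorization_def M by auto
  note factors = assms bij_betw_imp_surj_on[OF p] irr A B inner refl
  show "vec_space.rank (CARD('n) + 1) (A i) = 1" if "i < dim_row M" for i
    using rank_vertex_factor[OF factors] that M by simp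
  show "vec_space.rank (CARD('n) + 1) (B j) = 1" if "j < dim_col M" for j
    using rank_facet_factor[OF factors] that M by simp
qed

end
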